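(* Let $N\in\mathbb{N}$, $N\geq 2$, let $\mathcal{H}$ be a Hilbert space, and let $(S_j)_{0\leq j<N}$ be a representation of the Cuntz algebra $\mathcal{O}_N$ on $\mathcal{H}$. Let $(X,d)$ be a compact metric space and let $(\sigma_j)_{0\leq j<N}$ be an iterated function system on $X$ which is complete and non-overlapping. Then there is a unique projection valued measure $P$ defined on the Borel subsets of $X$ such that $$P\left(A_k(i_1,\dots,i_k)\right)=S_{i_1}\cdots S_{i_k}S_{i_k}^{*}\cdots S_{i_1}^{*}$$ for all $k\geq 1$ and all $(i_1,\dots,i_k)\in\{0,1,\dots,N-1\}^k$. This measure satisfies: (a) $P(E)=P(E)^{*}=P(E)^{2}$ for all $E\in\mathcal{B}(X)$. (b) $\int_X dP(x)=I_{\mathcal{H}}$. (c) $P(E)P(F)=0$ if $E,F\in\mathcal{B}(X)$ and $E\cap F=\varnothing$. (d) $\sum_{j=0}^{N-1}S_jP(\sigma_j^{-1}(E))S_j^{*}=P(E)$ for all $E\in\mathcal{B}(X)$. It follows in particular that, for every $f\in\mathcal{H}$, the measure $\mu_f(\cdot):=\|P(\cdot)f\|^{2}$ satisfies $$\sum_{j=0}^{N-1}\mu_{S_j^{*}f}\circ\sigma_j^{-1}=\mu_f,$$ or equivalently $$\sum_{j=0}^{N-1}\int_X\psi\circ\sigma_j\,d\mu_{S_j^{*}f}=\int_X\psi\,d\mu_f$$ for all bounded Borel functions $\psi$ on $X$.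
   Context: A representation of the Cuntz algebra $\mathcal{O}_N$ on $\mathcal{H}$ is a system $(S_j)_{0\leq j<N}$ of bounded operators on $\mathcal{H}$ with $S_j^{*}S_k=\delta_{j,k}I$ and $\sum_{j=0}^{N-1}S_jS_j^{*}=I$. An iterated function system (IFS) on a compact metric space $(X,d)$ is a finite system of continuous maps $\sigma_j:X\to X$, $0\le j<N$, for which there is a mapping $\sigma:X\to X$, onto $X$, with $\sigma\circ\sigma_j=\mathrm{id}_X$ for all $j$. Put $A_k(i_1,\dots,i_k):=\sigma_{i_1}\circ\cdots\circ\sigma_{i_k}(X)$. The IFS is complete if $\lim_{k\to\infty}\operatorname{diam}(\sigma_{i_1}\circ\cdots\circ\sigma_{i_k}(X))=0$. It is non-overlapping if for every $k$ the sets $A_k(i_1,\dots,i_k)$ are mutually disjoint for different multi-indices $(i_1,\dots,i_k)\in\{0,1,\dots,N-1\}^k$. $\mathcal{B}(X)$ denotes the Borel subsets of $X$. A projection valued measure is a countably additive (in the strong operator topology) map from $\mathcal{B}(X)$ to the orthogonal projections of $\mathcal{H}$ satisfying (a), (b), (c). For a measure $\mu$, $\mu\circ\sigma_j^{-1}(E)=\mu(\sigma_j^{-1}(E))$, where $\sigma_j^{-1}(E)=\{x:\sigma_j(x)\in E\}$. *)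

theory Defs
  imports "HOL-Analysis.Analysis"
begin

section \<open>Complex Hilbert spaces and bounded operators\<close>

class complex_inner = real_normed_vector +
  fixes scaleC :: "complex \<Rightarrow> 'a \<Rightarrow> 'a"  (infixr "*\<^sub>C" 75)
    and cinner :: "'a \<Rightarrow> 'a \<Rightarrow> complex"
  assumes scaleC_add_right: "a *\<^sub>C (x + y) = a *\<^sub>C x + a *\<^sub>C y"
    and scaleC_add_left: "(a + b) *\<^sub>C x = a *\<^sub>C x + b *\<^sub>C x"
    and scaleC_scaleC: "a *\<^sub>C b *\<^sub>C x = (a * b) *\<^sub>C x"
    and scaleR_scaleC: "r *\<^sub>R x = complex_of_real r *\<^sub>C x"
    and cinner_commute: "cinner x y = cnj (cinner y x)"
    and cinner_add_right: "cinner x (y + z) = cinner x y + cinner x z"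
    and cinner_scaleC_right: "cinner x (a *\<^sub>C y) = a * cinner x y"
    and cinner_self: "cinner x x = complex_of_real ((norm x)\<^sup>2)"

class complex_hilbert = complex_inner + complete_space

definition bounded_clinear :: "('h::complex_inner \<Rightarrow> 'h) \<Rightarrow> bool" where
  "bounded_clinear T \<longleftrightarrow> bounded_linear T \<and> (\<forall>c x. T (c *\<^sub>C x) = c *\<^sub>C T x)"

text \<open>On a Hilbert space every bounded operator has exactly one adjoint, so the choice is
  immaterial whenever \<open>T\<close> is bounded.\<close>

definition cadjoint :: "('h::complex_inner \<Rightarrow> 'h) \<Rightarrow> 'h \<Rightarrow> 'h" where
  "cadjoint T = (SOME T'. \<forall>x y. cinner (T x) y = cinner x (T' y))"

definition orth_projection :: "('h::complex_inner \<Rightarrow> 'h) \<Rightarrow> bool" where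
  "orth_projection T \<longleftrightarrow> bounded_clinear T \<and> cadjoint T = T \<and> T \<circ> T = T"

definition cuntz_representation :: "nat \<Rightarrow> (nat \<Rightarrow> 'h::complex_hilbert \<Rightarrow> 'h) \<Rightarrow> bool" where
  "cuntz_representation N S \<longleftrightarrow>
     (\<forall>j<N. bounded_clinear (S j)) \<and>
     (\<forall>j<N. \<forall>k<N. cadjoint (S j) \<circ> S k = (if j = k then id else (\<lambda>_. 0))) \<and>
     (\<lambda>x. \<Sum>j<N. (S j \<circ> cadjoint (S j)) x) = id"

text \<open>\<open>compose_word f [i\<^sub>1, \<dots>, i\<^sub>k] = f i\<^sub>1 \<circ> \<dots> \<circ> f i\<^sub>k\<close>; it is used both for operators and
  for the maps of an iterated function system.\<close>

definition compose_word :: "(nat \<Rightarrow> 'a \<Rightarrow> 'a) \<Rightarrow> nat list \<Rightarrow> 'a \<Rightarrow> 'a" where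
  "compose_word f w = foldr (\<lambda>i g. f i \<circ> g) w id"


section \<open>Iterated function systems\<close>

text \<open>The compact metric space \<open>X\<close> is a whole type. The left inverse \<open>\<tau>\<close> is not required to be
  continuous.\<close>

definition ifs :: "nat \<Rightarrow> (nat \<Rightarrow> 'x::metric_space \<Rightarrow> 'x) \<Rightarrow> bool" where
  "ifs N \<sigma> \<longleftrightarrow>
     (\<forall>j<N. continuous_on UNIV (\<sigma> j)) \<and>
     (\<exists>\<tau>. surj \<tau> \<and> (\<forall>j<N. \<tau> \<circ> \<sigma> j = id))"

definition cylinder :: "(nat \<Rightarrow> 'x \<Rightarrow> 'x) \<Rightarrow> nat list \<Rightarrow> 'x set" where
  "cylinder \<sigma> w = range (compose_word \<sigma> w)"

definition complete_ifs :: "nat \<Rightarrow> (nat \<Rightarrow> 'x::metric_space \<Rightarrow> 'x) \<Rightarrow> bool" where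
  "complete_ifs N \<sigma> \<longleftrightarrow>
     (\<forall>i::nat \<Rightarrow> nat. (\<forall>n. i n < N) \<longrightarrow>
        (\<lambda>k. diameter (cylinder \<sigma> (map i [0..<k]))) \<longlonglongrightarrow> 0)"

definition non_overlapping_ifs :: "nat \<Rightarrow> (nat \<Rightarrow> 'x \<Rightarrow> 'x) \<Rightarrow> bool" where
  "non_overlapping_ifs N \<sigma> \<longleftrightarrow>
     (\<forall>v w. length v = length w \<and> set v \<subseteq> {..<N} \<and> set w \<subseteq> {..<N} \<and> v \<noteq> w
        \<longrightarrow> cylinder \<sigma> v \<inter> cylinder \<sigma> w = {})"


section \<open>Projection valued measures\<close>

text \<open>Only the values of \<open>P\<close> on Borel sets matter.\<close>

definition pvm :: "('x::topological_space set \<Rightarrow> 'h::complex_hilbert \<Rightarrow> 'h) \<Rightarrow> bool" where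
  "pvm P \<longleftrightarrow>
     (\<forall>E\<in>sets borel. orth_projection (P E)) \<and>
     (\<forall>F::nat \<Rightarrow> 'x set. range F \<subseteq> sets borel \<and> disjoint_family F \<longrightarrow>
        (\<forall>f. (\<lambda>n. P (F n) f) sums P (\<Union>n. F n) f)) \<and>
     P UNIV = id \<and>
     (\<forall>E\<in>sets borel. \<forall>F\<in>sets borel. E \<inter> F = {} \<longrightarrow> P E \<circ> P F = (\<lambda>_. 0))"

definition pvm_measure ::
    "('x::topological_space set \<Rightarrow> 'h::complex_hilbert \<Rightarrow> 'h) \<Rightarrow> 'h \<Rightarrow> 'x measure" where
  "pvm_measure P f = measure_of UNIV (sets borel) (\<lambda>E. ennreal ((norm (P E f))\<^sup>2))"

text \<open>The operator \<open>\<integral> \<psi> dP\<close> for bounded Borel \<open>\<psi>\<close>, determined by its quadratic form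
  \<open>\<langle>f, (\<integral> \<psi> dP) f\<rangle> = \<integral> \<psi> d\<mu>\<^sub>f\<close>, where \<open>\<mu>\<^sub>f(E) = \<parallel>P(E) f\<parallel>\<^sup>2 = \<langle>f, P(E) f\<rangle>\<close>.\<close>

definition pvm_integral ::
    "('x::topological_space set \<Rightarrow> 'h::complex_hilbert \<Rightarrow> 'h) \<Rightarrow> ('x \<Rightarrow> complex) \<Rightarrow> 'h \<Rightarrow> 'h" where
  "pvm_integral P \<psi> = (THE T. bounded_clinear T \<and>
     (\<forall>f. cinner f (T f) = (\<integral>x. \<psi> x \<partial>pvm_measure P f)))"

text \<open>For a word \<open>w\<close>, the operator on the right is
  \<open>S\<^bsub>i\<^sub>1\<^esub> \<dots> S\<^bsub>i\<^sub>k\<^esub> S\<^bsub>i\<^sub>k\<^esub>\<^sup>* \<dots> S\<^bsub>i\<^sub>1\<^esub>\<^sup>*\<close>.\<close>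

definition extends_cylinder_projections ::
    "nat \<Rightarrow> (nat \<Rightarrow> 'h::complex_hilbert \<Rightarrow> 'h) \<Rightarrow> (nat \<Rightarrow> 'x \<Rightarrow> 'x)
      \<Rightarrow> ('x set \<Rightarrow> 'h \<Rightarrow> 'h) \<Rightarrow> bool" where
  "extends_cylinder_projections N S \<sigma> P \<longleftrightarrow>
     (\<forall>w. w \<noteq> [] \<and> set w \<subseteq> {..<N} \<longrightarrow>
        P (cylinder \<sigma> w) = compose_word S w \<circ> compose_word (\<lambda>j. cadjoint (S j)) (rev w))"

end

theory Submission
  imports Defs
begin

text \<open>For a vector \<open>f\<close>, cut the interval \<open>[0, \<parallel>f\<parallel>\<^sup>2)\<close> successively into pieces of length
  \<open>\<parallel>S\<^sub>w\<^sup>*f\<parallel>\<^sup>2\<close>, one for each word \<open>w\<close>. A real number in the interval thereby determines an infinite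
  word, hence a point of \<open>X\<close>, and the image of Lebesgue measure under this coding is a Borel
  measure \<open>\<mu>\<^sub>f\<close> that gives the cylinder of \<open>w\<close> the mass \<open>\<parallel>S\<^sub>w\<^sup>*f\<parallel>\<^sup>2\<close>. The Borel sets \<open>E\<close> for which some
  orthogonal projection \<open>T\<close> satisfies \<open>\<parallel>Tf\<parallel>\<^sup>2 = \<mu>\<^sub>f(E)\<close> for all \<open>f\<close> form a Dynkin system, because
  projections dominated in this way by \<open>\<parallel>f\<parallel>\<^sup>2\<close> on disjoint sets are mutually orthogonal and their
  sum converges strongly. This system contains the cylinders and all Borel sets that miss the
  limit set, hence all Borel sets; \<open>T\<close> is determined by its quadratic form, and \<open>P(E) = T\<close>.
  Uniqueness and self-similarity follow by the same induction over Borel sets. The adjoint of a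
  bounded operator, defined by choice, exists by the Riesz representation theorem, proved here by
  minimising \<open>\<parallel>x\<parallel>\<^sup>2/2 - \<phi>(x)\<close>.\<close>

section \<open>Adjoints on complex Hilbert spaces\<close>

lemma cinner_add_left: "cinner (x + y) z = cinner x z + cinner (y::'h::complex_inner) z"
  by (metis cinner_add_right cinner_commute complex_cnj_add)

lemma cinner_scaleC_left: "cinner (a *\<^sub>C x) y = cnj a * cinner (x::'h::complex_inner) y"
  by (metis cinner_commute cinner_scaleC_right complex_cnj_mult)

lemma cinner_scaleR_left: "cinner (r *\<^sub>R x) y = of_real r * cinner (x::'h::complex_inner) y"
  by (simp add: scaleR_scaleC cinner_scaleC_left)

lemma cinner_scaleR_right: "cinner x (r *\<^sub>R y) = of_real r * cinner (x::'h::complex_inner) y"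
  by (simp add: scaleR_scaleC cinner_scaleC_right)

lemma cinner_zero_right [simp]: "cinner (x::'h::complex_inner) 0 = 0"
  using cinner_scaleR_right[of x 0 x] by simp

lemma cinner_diff_right: "cinner x (y - z) = cinner x y - cinner (x::'h::complex_inner) z"
  using cinner_add_right[of x "y - z" z] by simp

lemma cinner_diff_left: "cinner (x - y) z = cinner x z - cinner (y::'h::complex_inner) z"
  using cinner_add_left[of "x - y" y z] by simp

lemma cinner_sum_right: "cinner x (\<Sum>i\<in>A. f i) = (\<Sum>i\<in>A. cinner (x::'h::complex_inner) (f i))"
  by (induction A rule: infinite_finite_induct) (auto simp: cinner_add_right)

lemma scaleC_diff_right: "c *\<^sub>C (x - y) = c *\<^sub>C x - c *\<^sub>C (y::'h::complex_inner)"
  using scaleC_add_right[of c "x - y" y] by simp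

lemma norm_scaleC: "norm (c *\<^sub>C (x::'h::complex_inner)) = cmod c * norm x"
proof -
  have "complex_of_real ((norm (c *\<^sub>C x))\<^sup>2) = cnj c * c * complex_of_real ((norm x)\<^sup>2)"
    by (simp only: cinner_self[symmetric] cinner_scaleC_left cinner_scaleC_right mult.assoc mult.left_commute)
  also have "\<dots> = complex_of_real ((cmod c * norm x)\<^sup>2)"
    by (simp add: mult.commute[of "cnj c"] complex_norm_square[symmetric] power_mult_distrib)
  finally have "(norm (c *\<^sub>C x))\<^sup>2 = (cmod c * norm x)\<^sup>2"
    using of_real_eq_iff by blast
  then show ?thesis by (simp add: power2_eq_iff_nonneg)
qed

lemma tendsto_scaleC:
  fixes g :: "'a \<Rightarrow> 'h::complex_inner"
  assumes "(g \<longlongrightarrow> l) F"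
  shows "((\<lambda>n. c *\<^sub>C g n) \<longlongrightarrow> c *\<^sub>C l) F"
proof -
  have "((\<lambda>n. cmod c * norm (g n - l)) \<longlongrightarrow> cmod c * 0) F"
    using assms by (intro tendsto_mult tendsto_const) (auto intro: tendsto_norm_zero LIM_zero)
  then show ?thesis
    by (subst tendsto_iff) (simp add: dist_norm flip: scaleC_diff_right, simp add: norm_scaleC tendsto_iff)
qed

lemma norm_add_square:
  "(norm (x + y))\<^sup>2 = (norm x)\<^sup>2 + (norm y)\<^sup>2 + 2 * Re (cinner x (y::'h::complex_inner))"
proof -
  have "Re (cinner y x) = Re (cinner x y)"
    by (subst cinner_commute) simp
  moreover have "(norm z)\<^sup>2 = Re (cinner z z)" for z :: 'h
    by (simp only: cinner_self Re_complex_of_real)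
  ultimately show ?thesis
    by (simp add: cinner_add_left cinner_add_right)
qed

lemma norm_diff_square:
  "(norm (x - y))\<^sup>2 = (norm x)\<^sup>2 + (norm y)\<^sup>2 - 2 * Re (cinner x (y::'h::complex_inner))"
  using norm_add_square[of x "-1 *\<^sub>R y"] cinner_scaleR_right[of x "-1" y] by simp

text \<open>The norm already satisfies the triangle inequality, so the real Cauchy-Schwarz
  inequality drops out of expanding the squared norm of \<open>x + y\<close>.\<close>

lemma Re_cinner_le: "Re (cinner x y) \<le> norm x * norm (y::'h::complex_inner)"
proof -
  have "(norm (x + y))\<^sup>2 \<le> (norm x + norm y)\<^sup>2"
    by (intro power_mono norm_triangle_ineq norm_ge_zero)
  then show ?thesis by (simp add: norm_add_square power2_sum)
qed

lemma abs_Re_cinner_le: "\<bar>Re (cinner x y)\<bar> \<le> norm x * norm (y::'h::complex_inner)"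
  using Re_cinner_le[of x y] Re_cinner_le[of x "-1 *\<^sub>R y"] cinner_scaleR_right[of x "-1" y] by simp

text \<open>Replacing \<open>y\<close> by \<open>\<i> *\<^sub>C y\<close> turns the imaginary part
  into a real part, so statements about real parts carry over to the complex inner product.\<close>

lemma cinner_eq_complex:
  "cinner x y = Complex (Re (cinner x y)) (- Re (cinner x (\<i> *\<^sub>C (y::'h::complex_inner))))"
  by (simp add: cinner_scaleC_right complex_eq_iff)

text \<open>By polarisation the real part is a continuous expression in norms.\<close>

lemma tendsto_cinner:
  fixes f g :: "'a \<Rightarrow> 'h::complex_inner"
  assumes f: "(f \<longlongrightarrow> k) F" and g: "(g \<longlongrightarrow> l) F"
  shows "((\<lambda>n. cinner (f n) (g n)) \<longlongrightarrow> cinner k l) F"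
proof -
  have re: "((\<lambda>n. Re (cinner (f n) (h n))) \<longlongrightarrow> Re (cinner k m)) F"
    if h: "(h \<longlongrightarrow> m) F" for h and m :: 'h
  proof -
    have e: "Re (cinner x y) = ((norm (x + y))\<^sup>2 - (norm x)\<^sup>2 - (norm y)\<^sup>2) / 2" for x y :: 'h
      by (simp add: norm_add_square)
    show ?thesis unfolding e by (intro tendsto_intros f h) simp
  qed
  show ?thesis
    by (subst cinner_eq_complex, subst (2) cinner_eq_complex, intro tendsto_Complex tendsto_minus re
      tendsto_scaleC g)
qed

lemma cinner_right_eqI:
  assumes "\<And>x. cinner x y = cinner x (z::'h::complex_inner)"
  shows "y = z"
proof -
  have "cinner (y - z) (y - z) = 0"
    using assms by (simp add: cinner_diff_right)
  then show ?thesis by (simp add: cinner_self)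
qed

text \<open>A minimising sequence of \<open>J\<close> is Cauchy by the parallelogram law. Its limit
  \<open>z\<close> attains the minimum, and stationarity of \<open>J\<close> at \<open>z\<close> in
  the direction \<open>y\<close> is the equation claimed.\<close>

lemma riesz_representation_Re:
  fixes \<phi> :: "'h::complex_hilbert \<Rightarrow> real"
  assumes "bounded_linear \<phi>"
  shows "\<exists>z. \<forall>y. Re (cinner z y) = \<phi> y"
proof -
  interpret bounded_linear \<phi> by fact
  obtain K where K: "\<And>x. \<bar>\<phi> x\<bar> \<le> norm x * K"
    using bounded by (auto simp: real_norm_def)
  define J where "J x = (norm x)\<^sup>2 / 2 - \<phi> x" for x
  \<comment> \<open>Completing the square in \<open>norm x\<close> bounds \<open>J\<close> from
    below.\<close>
  have J_ge: "- K\<^sup>2 / 2 \<le> J x" for x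
  proof -
    have "0 \<le> (norm x - K)\<^sup>2" by simp
    with K[of x] show ?thesis by (simp add: J_def power2_diff)
  qed
  define m where "m = Inf (range J)"
  have bdd: "bdd_below (range J)" using J_ge by (meson bdd_belowI2)
  have m_le: "m \<le> J x" for x unfolding m_def by (intro cInf_lower bdd) auto
  have "\<exists>x. J x < m + e" if "e > 0" for e
    using cInf_lessD[of "range J" "m + e"] that by (auto simp: m_def)
  then have "\<exists>x. J x < m + 1 / real (Suc n)" for n by simp
  then obtain X where X: "\<And>n. J (X n) < m + 1 / real (Suc n)" by metis
  \<comment> \<open>Parallelogram law: \<open>J x + J y\<close> exceeds twice the value of
    \<open>J\<close> at the midpoint by a quarter of the squared distance, and that value is at
    least \<open>m\<close>.\<close>
  have midpoint: "(norm (x - y))\<^sup>2 \<le> 4 * ((J x - m) + (J y - m))" for x y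
  proof -
    have "J ((1/2) *\<^sub>R (x + y)) = (norm (x + y))\<^sup>2 / 8 - (\<phi> x + \<phi> y) / 2"
      by (simp only: J_def scaleR add norm_scaleR) (simp add: power_divide field_simps)
    with m_le[of "(1/2) *\<^sub>R (x + y)"] show ?thesis
      unfolding norm_diff_square norm_add_square J_def[of x] J_def[of y] by argo
  qed
  have "Cauchy X"
  proof (rule CauchyI)
    fix e :: real assume e: "e > 0"
    \<comment> \<open>Two excesses over \<open>m\<close>, each below \<open>e\<^sup>2 / 8\<close>,
      enter \<open>midpoint\<close> with the factor 4.\<close>
    have "e\<^sup>2 / 8 > 0" using e by simp
    then obtain n0 where n0: "1 / real (Suc n0) < e\<^sup>2 / 8"
      using nat_approx_posE by blast
    have "norm (X a - X b) < e" if "a \<ge> n0" "b \<ge> n0" for a b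
    proof -
      have "1 / real (Suc c) \<le> 1 / real (Suc n0)" if "c \<ge> n0" for c
        using that by (simp add: frac_le)
      then have "J (X c) - m < e\<^sup>2 / 8" if "c \<ge> n0" for c
        using X[of c] n0 that by (smt (verit))
      from this[OF that(1)] this[OF that(2)] have "(norm (X a - X b))\<^sup>2 < e\<^sup>2"
        using midpoint[of "X a" "X b"] by simp
      then show ?thesis using e by (simp add: power_less_imp_less_base)
    qed
    then show "\<exists>M. \<forall>a\<ge>M. \<forall>b\<ge>M. norm (X a - X b) < e" by blast
  qed
  then obtain z where z: "X \<longlonglongrightarrow> z" by (auto simp: Cauchy_convergent_iff convergent_def)
  have 1: "(\<lambda>n. J (X n)) \<longlonglongrightarrow> J z"
    unfolding J_def by (intro tendsto_intros tendsto z) auto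
  have 2: "(\<lambda>n. m + 1 / real (Suc n)) \<longlonglongrightarrow> m + 0"
    by (intro tendsto_add tendsto_const LIMSEQ_Suc lim_1_over_n)
  have "J z \<le> m"
    using LIMSEQ_le[OF 1 2] X by (auto intro: less_imp_le)
  then have min: "J z \<le> J x" for x using m_le order_trans by blast
  have "Re (cinner z y) = \<phi> y" for y
  proof (rule ccontr)
    define d where "d = \<phi> y - Re (cinner z y)"
    assume "Re (cinner z y) \<noteq> \<phi> y"
    then have d: "d \<noteq> 0" "norm y > 0" by (auto simp: d_def zero)
    \<comment> \<open>This \<open>t\<close> minimises the quadratic polynomial
      \<open>J (z + t *\<^sub>R y)\<close> in \<open>t\<close>.\<close>
    define t where "t = d / (norm y)\<^sup>2"
    have "J (z + t *\<^sub>R y) = J z - t * d + t\<^sup>2 * (norm y)\<^sup>2 / 2"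
      by (simp add: J_def d_def norm_add_square add scaleR cinner_scaleR_right algebra_simps power_mult_distrib)
    also have "\<dots> = J z - d\<^sup>2 / (norm y)\<^sup>2 / 2"
      using d by (simp add: t_def field_simps power2_eq_square)
    also have "\<dots> < J z" using d by simp
    finally show False using min by (simp add: leD)
  qed
  then show ?thesis by blast
qed

text \<open>For fixed \<open>y\<close> the Riesz theorem represents the real functional
  \<open>Re (cinner y (T x))\<close>; evaluating at \<open>\<i> *\<^sub>C x\<close> as well recovers
  the imaginary part.\<close>

lemma cadjoint_exists:
  fixes T :: "'h::complex_hilbert \<Rightarrow> 'h"
  assumes T: "bounded_clinear T"
  shows "\<exists>T'. \<forall>x y. cinner (T x) y = cinner x (T' y)"
proof -
  have "\<exists>z. \<forall>x. cinner z x = cinner y (T x)" for y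
  proof -
    interpret T: bounded_linear T using T by (simp add: bounded_clinear_def)
    obtain K where K: "\<And>x. norm (T x) \<le> norm x * K" using T.bounded by blast
    have "bounded_linear (\<lambda>x. Re (cinner y (T x)))"
    proof (rule bounded_linear_intro)
      fix x
      have "\<bar>Re (cinner y (T x))\<bar> \<le> norm y * (norm x * K)"
        by (rule order_trans[OF abs_Re_cinner_le]) (intro mult_left_mono K norm_ge_zero)
      then show "norm (Re (cinner y (T x))) \<le> norm x * (norm y * K)"
        by (simp add: algebra_simps)
    qed (auto simp: T.add T.scaleR cinner_add_right cinner_scaleR_right)
    then obtain z where z: "Re (cinner z x) = Re (cinner y (T x))" for x
      using riesz_representation_Re[of "\<lambda>x. Re (cinner y (T x))"] by auto
    have "cinner z x = cinner y (T x)" for x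
      using z[of x] z[of "\<i> *\<^sub>C x"] T by (subst (1 2) cinner_eq_complex) (simp add: bounded_clinear_def)
    then show ?thesis by blast
  qed
  then obtain T' where "\<And>x y. cinner (T' y) x = cinner y (T x)" by metis
  then have "cinner (T x) y = cinner x (T' y)" for x y by (metis cinner_commute)
  then show ?thesis by blast
qed

lemma cadjoint:
  fixes T :: "'h::complex_hilbert \<Rightarrow> 'h"
  assumes "bounded_clinear T"
  shows "cinner (T x) y = cinner x (cadjoint T y)"
  using someI_ex[OF cadjoint_exists[OF assms]] unfolding cadjoint_def by blast

lemma cadjoint_eqI:
  fixes T :: "'h::complex_hilbert \<Rightarrow> 'h"
  assumes "\<And>x y. cinner (T x) y = cinner x (T' y)"
  shows "cadjoint T = T'"
proof -
  have a: "\<forall>x y. cinner (T x) y = cinner x (cadjoint T y)"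
    unfolding cadjoint_def by (rule someI[where x = T']) (simp add: assms)
  show ?thesis by (intro ext cinner_right_eqI) (simp add: a[rule_format, symmetric] assms)
qed

section \<open>Bounded complex-linear operators and their adjoints\<close>

lemma bounded_clinearI:
  assumes "\<And>x y. T (x + y) = T x + T (y::'h::complex_inner)" "\<And>c x. T (c *\<^sub>C x) = c *\<^sub>C T x"
    "\<And>x. norm (T x) \<le> norm x * K"
  shows "bounded_clinear T"
  unfolding bounded_clinear_def
  using assms by (auto intro!: bounded_linear_intro[of T K] simp: scaleR_scaleC)

lemma bounded_clinearD:
  assumes "bounded_clinear T"
  shows "bounded_linear T" "T (c *\<^sub>C x) = c *\<^sub>C T x" "T (x + y) = T x + T y" "T (x - y) = T x - T y"
    "T 0 = 0"
  using assms by (auto simp: bounded_clinear_def bounded_linear.linear linear_add linear_diff linear_0)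

lemma bounded_clinear_compose:
  assumes "bounded_clinear T" "bounded_clinear U"
  shows "bounded_clinear (T \<circ> U)"
  using assms bounded_linear_compose[of T U] by (simp add: bounded_clinear_def o_def)

lemma bounded_clinear_diff:
  assumes "bounded_clinear T" "bounded_clinear U"
  shows "bounded_clinear (\<lambda>x. T x - U x)"
  using assms bounded_linear_sub[of T U] by (simp add: bounded_clinear_def scaleC_diff_right)

lemma bounded_clinear_id: "bounded_clinear (id::'h::complex_inner \<Rightarrow> 'h)"
  by (simp add: bounded_clinear_def id_def bounded_linear_ident)

lemma bounded_clinear_cadjoint:
  fixes T :: "'h::complex_hilbert \<Rightarrow> 'h"
  assumes T: "bounded_clinear T"
  shows "bounded_clinear (cadjoint T)"
proof -
  note a = cadjoint[OF T, symmetric]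
  obtain K where K: "\<And>x. norm (T x) \<le> norm x * K"
    using bounded_linear.bounded[OF bounded_clinearD(1)[OF T]] by blast
  show ?thesis
  proof (rule bounded_clinearI[where K = K])
    fix x
    let ?y = "cadjoint T x"
    have "(norm ?y)\<^sup>2 = Re (cinner (T ?y) x)"
      by (simp only: cadjoint[OF T] cinner_self Re_complex_of_real)
    also have "\<dots> \<le> norm ?y * K * norm x"
      by (rule order_trans[OF Re_cinner_le]) (intro mult_right_mono K norm_ge_zero)
    finally have *: "norm ?y * norm ?y \<le> norm ?y * (norm x * K)"
      by (simp add: power2_eq_square algebra_simps)
    show "norm ?y \<le> norm x * K"
    proof (cases "norm ?y = 0")
      case True
      \<comment> \<open>The bound \<open>K\<close> comes without a sign; it is nonnegative as soon
        as some nonzero vector exists.\<close>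
      have "K \<ge> 0" if "x \<noteq> 0"
        using K[of x] that by (smt (verit) mult_neg_pos norm_ge_zero mult.commute zero_less_norm_iff)
      with True show ?thesis by (cases "x = 0") auto
    qed (use * in simp)
  qed (rule cinner_right_eqI; simp add: a cinner_add_right cinner_scaleC_right)+
qed

lemma cadjoint_left:
  fixes T :: "'h::complex_hilbert \<Rightarrow> 'h"
  assumes "bounded_clinear T"
  shows "cinner (cadjoint T x) y = cinner x (T y)"
  by (metis cadjoint[OF assms] cinner_commute)

text \<open>Polarisation: \<open>f + g\<close> yields the symmetrised form, and a second use with
  \<open>\<i> *\<^sub>C g\<close> separates its two terms.\<close>

lemma cinner_quadratic_eqI:
  fixes T U :: "'h::complex_hilbert \<Rightarrow> 'h"
  assumes T: "bounded_clinear T" and U: "bounded_clinear U"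
    and eq: "\<And>f. cinner f (T f) = cinner f (U f)"
  shows "T = U"
proof -
  note D = bounded_clinearD[OF T] bounded_clinearD[OF U]
  have s: "cinner f (T g) + cinner g (T f) = cinner f (U g) + cinner g (U f)" for f g
    using eq[of "f + g"] eq[of f] eq[of g]
    by (simp add: D cinner_add_left cinner_add_right algebra_simps)
  have "cinner f (T g) = cinner f (U g)" for f g
    using s[of f g] s[of f "\<i> *\<^sub>C g"]
    by (simp add: D cinner_scaleC_left cinner_scaleC_right complex_eq_iff)
  then show ?thesis by (intro ext cinner_right_eqI)
qed

section \<open>Orthogonal projections\<close>

lemma orth_projectionI:
  fixes T :: "'h::complex_hilbert \<Rightarrow> 'h"
  assumes "bounded_clinear T" "\<And>x y. cinner (T x) y = cinner x (T y)" "\<And>x. T (T x) = T x"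
  shows "orth_projection T"
  using assms by (auto simp: orth_projection_def fun_eq_iff cadjoint_eqI)

lemma orth_projectionD:
  fixes T :: "'h::complex_hilbert \<Rightarrow> 'h"
  assumes "orth_projection T"
  shows "bounded_clinear T" "cinner (T x) y = cinner x (T y)" "T (T x) = T x"
  using assms cadjoint[of T x y] by (auto simp: orth_projection_def fun_eq_iff)

lemma orth_projection_cinner:
  fixes T :: "'h::complex_hilbert \<Rightarrow> 'h"
  assumes "orth_projection T"
  shows "cinner f (T f) = complex_of_real ((norm (T f))\<^sup>2)"
  by (metis orth_projectionD(2,3)[OF assms] cinner_self)

lemma orth_projection_pythagoras:
  fixes T :: "'h::complex_hilbert \<Rightarrow> 'h"
  assumes "orth_projection T"
  shows "(norm (f - T f))\<^sup>2 = (norm f)\<^sup>2 - (norm (T f))\<^sup>2"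
  by (simp add: norm_diff_square orth_projection_cinner[OF assms])

lemma orth_projection_norm_le:
  fixes T :: "'h::complex_hilbert \<Rightarrow> 'h"
  assumes "orth_projection T"
  shows "norm (T f) \<le> norm f"
  using orth_projection_pythagoras[OF assms, of f] by (smt (verit) power2_le_imp_le norm_ge_zero zero_le_power2)

text \<open>The quadratic form of a projection is the squared norm of its value, so equal norms mean
  equal quadratic forms.\<close>

lemma orth_projection_eqI:
  fixes T U :: "'h::complex_hilbert \<Rightarrow> 'h"
  assumes T: "orth_projection T" and U: "orth_projection U" and "\<And>f. norm (T f) = norm (U f)"
  shows "T = U"
  using assms by (intro cinner_quadratic_eqI orth_projectionD(1)) (simp_all add: orth_projection_cinner)

text \<open>At the vector \<open>U f\<close> the second summand already exhausts the right-hand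
  side. This turns additivity of scalar masses into orthogonality of projections.\<close>

lemma orth_projection_mult_zero:
  fixes T U :: "'h::complex_hilbert \<Rightarrow> 'h"
  assumes T: "orth_projection T" and U: "orth_projection U"
    and le: "\<And>f. (norm (T f))\<^sup>2 + (norm (U f))\<^sup>2 \<le> (norm f)\<^sup>2"
  shows "T (U f) = 0"
  using le[of "U f"] orth_projectionD(3)[OF U] by simp

lemma orth_projection_compl:
  fixes T :: "'h::complex_hilbert \<Rightarrow> 'h"
  assumes T: "orth_projection T"
  shows "orth_projection (\<lambda>f. f - T f)"
  using bounded_clinear_diff[OF bounded_clinear_id orth_projectionD(1)[OF T]]
    bounded_clinearD[OF orth_projectionD(1)[OF T]]
  by (intro orth_projectionI) (auto simp: orth_projectionD[OF T] cinner_diff_left cinner_diff_right)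

lemma orth_projection_id: "orth_projection (id::'h::complex_hilbert \<Rightarrow> 'h)"
  by (intro orth_projectionI bounded_clinear_id) auto

lemma orth_projection_zero: "orth_projection ((\<lambda>_. 0)::'h::complex_hilbert \<Rightarrow> 'h)"
  using orth_projection_compl[OF orth_projection_id] by simp

lemma orth_projection_sum:
  fixes T :: "nat \<Rightarrow> 'h::complex_hilbert \<Rightarrow> 'h"
  assumes T: "\<And>n. orth_projection (T n)" and orth: "\<And>m n f. m \<noteq> n \<Longrightarrow> T m (T n f) = 0"
  shows "orth_projection (\<lambda>f. \<Sum>i<n. T i f)"
proof (induction n)
  case 0
  show ?case by (simp add: orth_projection_zero)
next
  case (Suc n)
  define P where "P f = (\<Sum>i<n. T i f)" for f
  have IH: "orth_projection P" using Suc by (simp add: P_def[abs_def])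
  note P = bounded_clinearD[OF orth_projectionD(1)[OF IH]] and t = bounded_clinearD[OF orth_projectionD(1)[OF T]]
  have 1: "P (T n f) = 0" for f
    unfolding P_def by (intro sum.neutral) (auto simp: orth)
  have 2: "T n (P f) = 0" for f
    using linear_sum[OF bounded_linear.linear[OF t(1)], of n "\<lambda>i. T i f" "{..<n}"]
    by (simp add: P_def orth)
  have "bounded_clinear (\<lambda>f. P f + T n f)"
    using bounded_linear_add[OF P(1) t(1)[of n]]
    by (auto simp: bounded_clinear_def t P(2) scaleC_add_right)
  then have "orth_projection (\<lambda>f. P f + T n f)"
    using 1 2
    by (intro orth_projectionI)
      (auto simp: cinner_add_left cinner_add_right orth_projectionD(2)[OF IH] orth_projectionD(2)[OF T] t P(3)
        orth_projectionD(3)[OF IH] orth_projectionD(3)[OF T])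
  then show ?case by (simp add: P_def)
qed

text \<open>The partial sums \<open>P n\<close> are increasing projections, so the squared norm of
  \<open>P n f - P m f\<close> is a difference of terms of a bounded increasing sequence. Hence
  \<open>P n f\<close> is Cauchy, and the limit inherits linearity, symmetry and
  idempotence.\<close>

lemma orth_projection_sums:
  fixes T :: "nat \<Rightarrow> 'h::complex_hilbert \<Rightarrow> 'h"
  assumes T: "\<And>n. orth_projection (T n)" and orth: "\<And>m n f. m \<noteq> n \<Longrightarrow> T m (T n f) = 0"
  shows "\<exists>U. orth_projection U \<and> (\<forall>f. (\<lambda>n. T n f) sums U f) \<and>
    (\<forall>f. (\<lambda>n. (norm (T n f))\<^sup>2) sums (norm (U f))\<^sup>2)"
proof -
  define P where "P n f = (\<Sum>i<n. T i f)" for n f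
  have P: "orth_projection (P n)" for n
    unfolding P_def by (rule orth_projection_sum[OF T orth])
  note lin = bounded_clinearD[OF orth_projectionD(1)[OF P]]
  note linT = bounded_clinearD[OF orth_projectionD(1)[OF T]]
  have sum_sq: "(norm (P n f))\<^sup>2 = (\<Sum>i<n. (norm (T i f))\<^sup>2)" for n f
  proof -
    have "complex_of_real ((norm (P n f))\<^sup>2) = (\<Sum>i<n. cinner f (T i f))"
      unfolding orth_projection_cinner[OF P, symmetric] by (simp add: P_def cinner_sum_right)
    also have "\<dots> = complex_of_real (\<Sum>i<n. (norm (T i f))\<^sup>2)"
      by (simp add: orth_projection_cinner[OF T])
    finally show ?thesis using of_real_eq_iff by blast
  qed
  have PP: "P m (P n f) = P m f" if "m \<le> n" for m n f
  proof -
    have "T i (P n f) = T i f" if "i < m" for i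
    proof -
      have "T i (P n f) = (\<Sum>j<n. T i (T j f))"
        unfolding P_def using linear_sum[OF bounded_linear.linear[OF linT(1)]] by blast
      also have "\<dots> = (\<Sum>j<n. if j = i then T i f else 0)"
        by (intro sum.cong) (auto simp: orth orth_projectionD(3)[OF T])
      also have "\<dots> = T i f" using that \<open>m \<le> n\<close> by simp
      finally show ?thesis .
    qed
    then show ?thesis by (simp add: P_def[of m])
  qed
  have diff: "(norm (P n f - P m f))\<^sup>2 = (norm (P n f))\<^sup>2 - (norm (P m f))\<^sup>2" if "m \<le> n" for m n f
    using orth_projection_pythagoras[OF P, of "P n f" m] PP[OF that] by simp
  have conv: "convergent (\<lambda>n. P n f)" for f
  proof -
    have "summable (\<lambda>i. (norm (T i f))\<^sup>2)"
    proof (rule summableI_nonneg_bounded[where x = "(norm f)\<^sup>2"])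
      show "(\<Sum>i<n. (norm (T i f))\<^sup>2) \<le> (norm f)\<^sup>2" for n
        using orth_projection_norm_le[OF P, of n f] by (simp add: sum_sq[symmetric])
    qed auto
    then have Cs: "Cauchy (\<lambda>n. (norm (P n f))\<^sup>2)"
      by (auto simp: sum_sq summable_iff_convergent Cauchy_convergent_iff)
    have "Cauchy (\<lambda>n. P n f)"
    proof (rule CauchyI')
      fix e :: real assume e: "e > 0"
      then obtain M where M: "\<And>m n. m \<ge> M \<Longrightarrow> n \<ge> M \<Longrightarrow> \<bar>(norm (P m f))\<^sup>2 - (norm (P n f))\<^sup>2\<bar> < e\<^sup>2"
        using CauchyD[OF Cs, of "e\<^sup>2"] by auto
      have "dist (P m f) (P n f) < e" if "m \<ge> M" "n > m" for m n
      proof -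
        have "(norm (P n f - P m f))\<^sup>2 < e\<^sup>2"
          using diff[of m n f] M[of n m] that by simp
        then show ?thesis using e by (simp add: dist_norm norm_minus_commute power_less_imp_less_base)
      qed
      then show "\<exists>M. \<forall>m\<ge>M. \<forall>n>m. dist (P m f) (P n f) < e" by blast
    qed
    then show ?thesis by (simp add: Cauchy_convergent_iff)
  qed
  then obtain U where U: "\<And>f. (\<lambda>n. P n f) \<longlonglongrightarrow> U f" unfolding convergent_def by metis
  show ?thesis
  proof (intro exI conjI allI)
    show "(\<lambda>n. T n f) sums U f" for f using U by (simp add: sums_def P_def)
    show "(\<lambda>n. (norm (T n f))\<^sup>2) sums (norm (U f))\<^sup>2" for f
      unfolding sums_def sum_sq[symmetric] by (intro tendsto_intros U)
    \<comment> \<open>Passing to the limit in \<open>PP\<close>; a further limit in \<open>m\<close>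
      gives idempotence of \<open>U\<close>.\<close>
    have P_U: "P m (U f) = P m f" for m f
    proof (rule LIMSEQ_unique)
      show "(\<lambda>n. P m (P n f)) \<longlonglongrightarrow> P m (U f)" by (intro bounded_linear.tendsto[OF lin(1)] U)
      show "(\<lambda>n. P m (P n f)) \<longlonglongrightarrow> P m f"
        by (rule tendsto_eventually) (auto simp: eventually_sequentially PP intro: exI[of _ m])
    qed
    show "orth_projection U"
    proof (intro orth_projectionI bounded_clinearI[where K = 1])
      show "U (x + y) = U x + U y" for x y
        using U[of "x + y"] tendsto_add[OF U U] unfolding lin(3) by (rule LIMSEQ_unique)
      show "U (c *\<^sub>C x) = c *\<^sub>C U x" for c x
        using U[of "c *\<^sub>C x"] tendsto_scaleC[OF U] unfolding lin(2) by (rule LIMSEQ_unique)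
      show "norm (U x) \<le> norm x * 1" for x
        using Lim_bounded[OF tendsto_norm[OF U], of 0 x "norm x"] orth_projection_norm_le[OF P] by simp
      show "cinner (U x) y = cinner x (U y)" for x y
        using tendsto_cinner[OF U tendsto_const] tendsto_cinner[OF tendsto_const U]
        unfolding orth_projectionD(2)[OF P] by (rule LIMSEQ_unique)
      show "U (U x) = U x" for x
        using U[of "U x"] U[of x] unfolding P_U by (rule LIMSEQ_unique)
    qed
  qed
qed

section \<open>Cylinders and the limit set\<close>

lemma compose_word_Nil [simp]: "compose_word f [] = id"
  by (simp add: compose_word_def)

lemma compose_word_Cons [simp]: "compose_word f (i # w) = f i \<circ> compose_word f w"
  by (simp add: compose_word_def)

lemma compose_word_append: "compose_word f (v @ w) = compose_word f v \<circ> compose_word f w"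
  by (induction v) (auto simp: o_assoc)

lemma cylinder_Nil [simp]: "cylinder \<sigma> [] = UNIV"
  by (simp add: cylinder_def)

lemma cylinder_Cons: "cylinder \<sigma> (j # w) = \<sigma> j ` cylinder \<sigma> w"
  by (simp add: cylinder_def image_comp)

lemma cylinder_nonempty [simp]: "cylinder \<sigma> w \<noteq> {}"
  by (simp add: cylinder_def)

lemma cylinder_take_subset: "cylinder \<sigma> w \<subseteq> cylinder \<sigma> (take n w)"
proof -
  have "cylinder \<sigma> (u @ v) \<subseteq> cylinder \<sigma> u" for u v
    by (auto simp: cylinder_def compose_word_append)
  from this[of "take n w" "drop n w"] show ?thesis by simp
qed

locale compact_ifs =
  fixes N :: nat and \<sigma> :: "nat \<Rightarrow> 'x::metric_space \<Rightarrow> 'x"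
  assumes compact_UNIV: "compact (UNIV :: 'x set)"
    and ifs: "ifs N \<sigma>"
    and complete_ifs: "complete_ifs N \<sigma>"
    and non_overlapping: "non_overlapping_ifs N \<sigma>"
begin

abbreviation cyl :: "nat list \<Rightarrow> 'x set" where "cyl \<equiv> cylinder \<sigma>"

definition words :: "nat \<Rightarrow> nat list set" where
  "words k = {w. set w \<subseteq> {..<N} \<and> length w = k}"

text \<open>The attractor: points lying in a cylinder of every length. All the measures in question
  will turn out to be concentrated on it.\<close>

definition limit_set :: "'x set" where
  "limit_set = (\<Inter>k. \<Union>w\<in>words k. cyl w)"

lemma finite_words: "finite (words k)"
  unfolding words_def by (rule finite_lists_length_eq) simp

lemma continuous_sigma: "j < N \<Longrightarrow> continuous_on UNIV (\<sigma> j)"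
  using ifs by (simp add: ifs_def)

lemma inj_sigma:
  assumes "j < N" shows "inj (\<sigma> j)"
proof -
  obtain \<tau> where "\<tau> \<circ> \<sigma> j = id" using ifs assms by (auto simp: ifs_def)
  then show ?thesis by (metis inj_on_id inj_on_imageI2)
qed

lemma measurable_sigma: "j < N \<Longrightarrow> \<sigma> j \<in> borel_measurable borel"
  by (intro borel_measurable_continuous_onI continuous_sigma)

lemma vimage_sigma_borel: "j < N \<Longrightarrow> E \<in> sets borel \<Longrightarrow> \<sigma> j -` E \<in> sets borel"
  using measurable_sets[OF measurable_sigma, of j E] by simp

lemma compact_cyl: "set w \<subseteq> {..<N} \<Longrightarrow> compact (cyl w)"
proof (induction w)
  case (Cons j w)
  then show ?case
    unfolding cylinder_Cons
    by (intro compact_continuous_image continuous_on_subset[OF continuous_sigma]) auto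
qed (simp add: compact_UNIV)

lemma cyl_borel: "set w \<subseteq> {..<N} \<Longrightarrow> cyl w \<in> sets borel"
  by (intro borel_closed compact_imp_closed compact_cyl)

lemma cyl_disjoint:
  "set v \<subseteq> {..<N} \<Longrightarrow> set w \<subseteq> {..<N} \<Longrightarrow> length v = length w \<Longrightarrow> v \<noteq> w \<Longrightarrow> cyl v \<inter> cyl w = {}"
  using non_overlapping by (simp add: non_overlapping_ifs_def)

lemma cyl_eq_words:
  "v \<in> words k \<Longrightarrow> w \<in> words k \<Longrightarrow> x \<in> cyl v \<Longrightarrow> x \<in> cyl w \<Longrightarrow> v = w"
  using cyl_disjoint[of v w] by (auto simp: words_def)

text \<open>Injectivity of \<open>\<sigma> j\<close> cancels an equal first letter; for different
  first letters the ranges are disjoint by non-overlap at length one.\<close>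

lemma vimage_sigma_cyl:
  assumes "i < N" "j < N"
  shows "\<sigma> j -` cyl (i # w) = (if i = j then cyl w else {})"
proof (cases "i = j")
  case True
  then show ?thesis using assms inj_sigma by (simp add: cylinder_Cons inj_vimage_image_eq)
next
  case False
  then have "range (\<sigma> i) \<inter> range (\<sigma> j) = {}"
    using assms cyl_disjoint[of "[i]" "[j]"] by (simp add: cylinder_Cons)
  with False show ?thesis by (auto simp: cylinder_Cons)
qed

text \<open>Each \<open>\<sigma> j\<close> maps the limit set into itself, because prepending
  \<open>j\<close> to a word of length \<open>n\<close> gives a word of length
  \<open>Suc n\<close>.\<close>

lemma vimage_sigma_limit_set:
  assumes j: "j < N" and E: "E \<inter> limit_set = {}"
  shows "\<sigma> j -` E \<inter> limit_set = {}"
proof -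
  have "\<sigma> j x \<in> limit_set" if x: "x \<in> limit_set" for x
  proof -
    have "\<exists>w\<in>words k. \<sigma> j x \<in> cyl w" for k
    proof (cases k)
      case 0
      then show ?thesis by (intro bexI[of _ "[]"]) (auto simp: words_def)
    next
      case (Suc n)
      obtain w where "w \<in> words n" "x \<in> cyl w" using x by (auto simp: limit_set_def)
      then show ?thesis using j Suc by (intro bexI[of _ "j # w"]) (auto simp: words_def cylinder_Cons)
    qed
    then show ?thesis by (auto simp: limit_set_def)
  qed
  with E show ?thesis by auto
qed

text \<open>Non-overlap makes the word of each length unique, so the words containing
  \<open>x\<close> are prefixes of one another and fit together to one infinite word.\<close>

lemma address_exists:
  assumes x: "x \<in> limit_set"
  obtains i where "\<And>n. i n < N" "\<And>k. x \<in> cyl (map i [0..<k])"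
proof -
  have "\<forall>k. \<exists>w. w \<in> words k \<and> x \<in> cyl w" using x by (auto simp: limit_set_def)
  then obtain w where w: "\<And>k. w k \<in> words k" "\<And>k. x \<in> cyl (w k)" by metis
  have len: "length (w k) = k" for k using w(1)[of k] by (simp add: words_def)
  have take: "take n (w k) = w n" if "n \<le> k" for n k
    using that w(1)[of k] set_take_subset[of n "w k"]
    by (intro cyl_eq_words[OF _ w(1) subsetD[OF cylinder_take_subset w(2)] w(2)]) (auto simp: words_def)
  \<comment> \<open>The letter with index \<open>n\<close> is the last letter of the word of length
    \<open>Suc n\<close>.\<close>
  have "map (\<lambda>n. w (Suc n) ! n) [0..<k] = w k" for k
  proof (rule nth_equalityI)
    fix n assume "n < length (map (\<lambda>n. w (Suc n) ! n) [0..<k])"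
    then show "map (\<lambda>n. w (Suc n) ! n) [0..<k] ! n = w k ! n"
      using take[of "Suc n" k] nth_take[of n "Suc n" "w k"] by simp
  qed (simp add: len)
  moreover have "w (Suc n) ! n < N" for n
    using w(1)[of "Suc n"] nth_mem[of n "w (Suc n)"] by (auto simp: words_def simp del: nth_mem)
  ultimately show ?thesis using w(2) by (intro that[of "\<lambda>n. w (Suc n) ! n"]) auto
qed

lemma small_cyl:
  assumes i: "\<And>n. i n < N" and x: "\<And>k. x \<in> cyl (map i [0..<k])" and U: "open U" "x \<in> U"
  shows "\<exists>k. cyl (map i [0..<k]) \<subseteq> U"
proof -
  obtain e where e: "e > 0" "ball x e \<subseteq> U" using U openE by blast
  have "(\<lambda>k. diameter (cyl (map i [0..<k]))) \<longlonglongrightarrow> 0"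
    using complete_ifs i by (simp add: complete_ifs_def)
  then have "\<forall>\<^sub>F k in sequentially. diameter (cyl (map i [0..<k])) < e"
    using e by (simp add: order_tendstoD)
  then obtain k where k: "diameter (cyl (map i [0..<k])) < e"
    by (auto simp: eventually_sequentially)
  \<comment> \<open>Boundedness is what makes \<open>diameter\<close> an upper bound for
    distances.\<close>
  have "bounded (cyl (map i [0..<k]))"
    using compact_imp_bounded[OF compact_UNIV] bounded_subset by blast
  then have "cyl (map i [0..<k]) \<subseteq> ball x e"
    using k x diameter_bounded_bound by fastforce
  then show ?thesis using e by blast
qed

text \<open>Cylinders along an infinite word are nested nonempty compact sets, so the finite
  intersection property applies.\<close>

lemma address_point_exists:
  assumes i: "\<And>n. i n < N"
  shows "\<exists>x. \<forall>k. x \<in> cyl (map i [0..<k])"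
proof -
  have "UNIV \<inter> (\<Inter>k\<in>UNIV. cyl (map i [0..<k])) \<noteq> {}"
  proof (rule compact_imp_fip_image[OF compact_UNIV])
    show "closed (cyl (map i [0..<k]))" for k using i by (intro compact_imp_closed compact_cyl) auto
    show "UNIV \<inter> (\<Inter>k\<in>K. cyl (map i [0..<k])) \<noteq> {}" if "finite K" for K
    proof -
      have "cyl (map i [0..<Max K]) \<subseteq> cyl (map i [0..<k])" if "k \<in> K" for k
        using cylinder_take_subset[of \<sigma> "map i [0..<Max K]" k] that \<open>finite K\<close>
        by (simp add: take_map)
      then have "cyl (map i [0..<Max K]) \<subseteq> (\<Inter>k\<in>K. cyl (map i [0..<k]))" by blast
      then show ?thesis using cylinder_nonempty[of \<sigma> "map i [0..<Max K]"] by blast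
    qed
  qed
  then show ?thesis by blast
qed

text \<open>The cylinders generate the Borel sets only inside the limit set, which may be smaller than
  the whole space; hence the case \<open>null\<close>.\<close>

lemma borel_cylinder_induct [consumes 1, case_names null cylinder compl union]:
  assumes "E \<in> sets borel"
    and null: "\<And>E. E \<in> sets borel \<Longrightarrow> E \<inter> limit_set = {} \<Longrightarrow> Q E"
    and cylinder: "\<And>w. set w \<subseteq> {..<N} \<Longrightarrow> Q (cyl w)"
    and compl: "\<And>E. E \<in> sets borel \<Longrightarrow> Q E \<Longrightarrow> Q (- E)"
    and union: "\<And>F::nat \<Rightarrow> 'x set. range F \<subseteq> sets borel \<Longrightarrow> disjoint_family F \<Longrightarrow> (\<And>n. Q (F n)) \<Longrightarrow> Q (\<Union>n. F n)"
  shows "Q E"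
proof -
  \<comment> \<open>Open sets form an intersection-stable generator, so the Dynkin induction at the
    end needs \<open>Q\<close> only for them. An open set is cut into countably many disjoint
    cylinders and a rest off the limit set.\<close>
  have "Q U" if U: "open U" for U
  proof -
    \<comment> \<open>The shortest words whose cylinder fits into \<open>U\<close>. No word of
      \<open>W\<close> is a proper prefix of another, which makes their cylinders disjoint.\<close>
    define W where "W = {w. set w \<subseteq> {..<N} \<and> cyl w \<subseteq> U \<and> (\<forall>n<length w. \<not> cyl (take n w) \<subseteq> U)}"
    have disj_le: "cyl v \<inter> cyl w = {}" if "v \<in> W" "w \<in> W" "v \<noteq> w" "length v \<le> length w" for v w
    proof -
      have "take (length v) w \<noteq> v"
      proof
        assume take: "take (length v) w = v"
        with that have "length v < length w" by (cases "length v < length w") auto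
        with \<open>w \<in> W\<close> have "\<not> cyl (take (length v) w) \<subseteq> U" unfolding W_def by blast
        with take \<open>v \<in> W\<close> show False unfolding W_def by simp
      qed
      moreover have "set (take (length v) w) \<subseteq> {..<N}"
        using that set_take_subset[of "length v" w] by (auto simp: W_def)
      ultimately have "cyl v \<inter> cyl (take (length v) w) = {}"
        using that by (intro cyl_disjoint) (auto simp: W_def)
      then show ?thesis using cylinder_take_subset[of \<sigma> w "length v"] by blast
    qed
    have disj: "cyl v \<inter> cyl w = {}" if "v \<in> W" "w \<in> W" "v \<noteq> w" for v w
      using disj_le[of v w] disj_le[of w v] that by (cases "length v \<le> length w") auto
    have cover: "\<exists>w\<in>W. x \<in> cyl w" if x: "x \<in> U" "x \<in> limit_set" for x
    proof -
      obtain i where i: "\<And>n. i n < N" "\<And>k. x \<in> cyl (map i [0..<k])"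
        using address_exists[OF x(2)] by blast
      \<comment> \<open>The shortest prefix of the address whose cylinder fits into
        \<open>U\<close>; by minimality it belongs to \<open>W\<close>.\<close>
      define k where "k = (LEAST k. cyl (map i [0..<k]) \<subseteq> U)"
      have "cyl (map i [0..<k]) \<subseteq> U"
        unfolding k_def using small_cyl[OF i U x(1)] by (rule LeastI_ex)
      moreover have "\<not> cyl (map i [0..<n]) \<subseteq> U" if "n < k" for n
        using not_less_Least that unfolding k_def by blast
      ultimately have "map i [0..<k] \<in> W" using i(1) by (auto simp: W_def take_map)
      then show ?thesis using i(2) by blast
    qed
    \<comment> \<open>Index 0 holds the rest of \<open>U\<close>, index \<open>Suc m\<close> the
      cylinder of the word coded by \<open>m\<close>. As \<open>from_nat\<close> may repeat values,
      the test on \<open>to_nat\<close> keeps each word only once.\<close>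
    define F where "F n = (case n of 0 \<Rightarrow> U - (\<Union>w\<in>W. cyl w) |
      Suc m \<Rightarrow> if from_nat m \<in> W \<and> to_nat (from_nat m :: nat list) = m then cyl (from_nat m) else {})" for n
    have W_borel: "w \<in> W \<Longrightarrow> cyl w \<in> sets borel" for w by (auto simp: W_def intro: cyl_borel)
    have Un: "(\<Union>w\<in>W. cyl w) \<in> sets borel"
      by (intro sets.countable_UN'' W_borel) auto
    have F0: "F 0 \<in> sets borel" "F 0 \<inter> limit_set = {}"
      using Un U cover by (auto simp: F_def)
    have "Q (\<Union>n. F n)"
    proof (rule union)
      show "range F \<subseteq> sets borel" using F0 W_borel by (auto simp: F_def split: nat.split)
      show "disjoint_family F"
        unfolding disjoint_family_on_def
      proof (intro ballI impI)
        fix m n :: nat assume "m \<noteq> n"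
        then show "F m \<inter> F n = {}"
          using disj by (cases m; cases n) (auto simp: F_def, metis disj disjoint_iff)
      qed
      show "Q (F n)" for n
        using null[OF F0] null[of "{}"] cylinder by (cases n) (auto simp: F_def W_def)
    qed
    moreover have "(\<Union>n. F n) = U"
    proof
      show "(\<Union>n. F n) \<subseteq> U" by (auto simp: F_def W_def split: nat.splits if_splits)
      show "U \<subseteq> (\<Union>n. F n)"
      proof
        fix x assume x: "x \<in> U"
        show "x \<in> (\<Union>n. F n)"
        proof (cases "\<exists>w\<in>W. x \<in> cyl w")
          case True
          then obtain w where "w \<in> W" "x \<in> cyl w" by blast
          then have "x \<in> F (Suc (to_nat w))" by (simp add: F_def)
          then show ?thesis by blast
        next
          case False
          then have "x \<in> F 0" using x by (simp add: F_def)
          then show ?thesis by blast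
        qed
      qed
    qed
    ultimately show ?thesis by simp
  qed
  note open_case = this
  have gen: "sigma_sets UNIV {S :: 'x set. open S} = sets borel"
    by (simp add: sets_borel)
  have "Int_stable {S :: 'x set. open S}" by (auto simp: Int_stable_def)
  moreover have "{S :: 'x set. open S} \<subseteq> Pow UNIV" by simp
  moreover have "E \<in> sigma_sets UNIV {S. open S}" using assms(1) by (simp add: gen)
  ultimately show ?thesis
  proof (induction rule: sigma_sets_induct_disjoint)
    case (basic A)
    then show ?case using open_case by simp
  next
    case empty
    show ?case by (rule null) auto
  next
    case (compl A)
    then show ?case using assms(4)[of A] by (simp add: gen Compl_eq_Diff_UNIV)
  next
    case (union A)
    then show ?case using assms(5)[of A] by (simp add: gen)
  qed
qed

end

section \<open>Cuntz representations and the coding of Lebesgue measure\<close>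

locale cuntz =
  fixes N :: nat and S :: "nat \<Rightarrow> 'h::complex_hilbert \<Rightarrow> 'h"
  assumes cuntz: "cuntz_representation N S"
begin

abbreviation S_adj :: "nat \<Rightarrow> 'h \<Rightarrow> 'h" where "S_adj j \<equiv> cadjoint (S j)"

text \<open>Taking adjoints reverses products, so this is the adjoint of
  \<open>compose_word S w\<close> for words over the alphabet.\<close>

definition adj_word :: "nat list \<Rightarrow> 'h \<Rightarrow> 'h" where
  "adj_word w = compose_word S_adj (rev w)"

definition word_projection :: "nat list \<Rightarrow> 'h \<Rightarrow> 'h" where
  "word_projection w = compose_word S w \<circ> adj_word w"

lemma bounded_clinear_S: "j < N \<Longrightarrow> bounded_clinear (S j)"
  using cuntz by (simp add: cuntz_representation_def)

lemma bounded_clinear_S_adj: "j < N \<Longrightarrow> bounded_clinear (S_adj j)"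
  by (intro bounded_clinear_cadjoint bounded_clinear_S)

lemma S_adj_S: "j < N \<Longrightarrow> S_adj j (S j x) = x"
  using cuntz by (auto simp: cuntz_representation_def fun_eq_iff)

lemma sum_S_S_adj: "(\<Sum>j<N. S j (S_adj j x)) = x"
  using cuntz by (auto simp: cuntz_representation_def fun_eq_iff)

lemma norm_S:
  assumes "j < N" shows "norm (S j x) = norm x"
proof -
  have "complex_of_real ((norm (S j x))\<^sup>2) = complex_of_real ((norm x)\<^sup>2)"
    using assms by (simp only: cinner_self[symmetric] cadjoint[OF bounded_clinear_S] S_adj_S)
  then show ?thesis using of_real_eq_iff power2_eq_iff_nonneg norm_ge_zero by blast
qed

text \<open>Pair the resolution of the identity with \<open>f\<close>. This is why the first-level
  intervals fill the interval of length \<open>(norm f)\<^sup>2\<close> exactly.\<close>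

lemma sum_norm_S_adj: "(\<Sum>j<N. (norm (S_adj j f))\<^sup>2) = (norm f)\<^sup>2"
proof -
  have "complex_of_real (\<Sum>j<N. (norm (S_adj j f))\<^sup>2) = (\<Sum>j<N. cinner f (S j (S_adj j f)))"
    unfolding of_real_sum
    by (intro sum.cong refl) (simp only: lessThan_iff cinner_self[symmetric] cadjoint_left[OF bounded_clinear_S])
  also have "\<dots> = complex_of_real ((norm f)\<^sup>2)"
    by (simp add: cinner_sum_right[symmetric] sum_S_S_adj cinner_self)
  finally show ?thesis using of_real_eq_iff by blast
qed

lemma adj_word_Nil [simp]: "adj_word [] = id"
  by (simp add: adj_word_def)

lemma adj_word_Cons [simp]: "adj_word (j # w) = adj_word w \<circ> S_adj j"
  by (simp add: adj_word_def compose_word_append)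

lemma norm_compose_word_S: "set w \<subseteq> {..<N} \<Longrightarrow> norm (compose_word S w x) = norm x"
  by (induction w) (auto simp: norm_S)

lemma norm_word_projection: "set w \<subseteq> {..<N} \<Longrightarrow> norm (word_projection w f) = norm (adj_word w f)"
  by (simp add: word_projection_def norm_compose_word_S)

text \<open>Idempotence survives since \<open>S_adj j\<close> cancels \<open>S j\<close> in the
  middle.\<close>

lemma orth_projection_conjugate:
  assumes j: "j < N" and T: "orth_projection T"
  shows "orth_projection (S j \<circ> T \<circ> S_adj j)"
proof (rule orth_projectionI)
  show "bounded_clinear (S j \<circ> T \<circ> S_adj j)"
    using j T by (intro bounded_clinear_compose bounded_clinear_S bounded_clinear_S_adj orth_projectionD(1))
  show "cinner ((S j \<circ> T \<circ> S_adj j) x) y = cinner x ((S j \<circ> T \<circ> S_adj j) y)" for x y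
    using j by (simp add: cadjoint[OF bounded_clinear_S] cadjoint_left[OF bounded_clinear_S] orth_projectionD(2)[OF T])
qed (simp add: S_adj_S[OF j] orth_projectionD(3)[OF T])

lemma orth_projection_word: "set w \<subseteq> {..<N} \<Longrightarrow> orth_projection (word_projection w)"
proof (induction w)
  case Nil
  then show ?case using orth_projection_id by (simp add: word_projection_def id_def)
next
  case (Cons j w)
  then have "orth_projection (S j \<circ> word_projection w \<circ> S_adj j)"
    by (intro orth_projection_conjugate) auto
  then show ?case by (simp add: word_projection_def o_def)
qed

end

section \<open>Coding real numbers by infinite words\<close>

locale cuntz_ifs = cuntz N S + compact_ifs N \<sigma>
  for N and S :: "nat \<Rightarrow> 'h::complex_hilbert \<Rightarrow> 'h" and \<sigma> :: "nat \<Rightarrow> 'x::metric_space \<Rightarrow> 'x"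
begin

definition start :: "'h \<Rightarrow> nat \<Rightarrow> real" where
  "start f j = (\<Sum>i<j. (norm (S_adj i f))\<^sup>2)"

text \<open>For each length \<open>k\<close>, the interval \<open>[0, \<parallel>f\<parallel>\<^sup>2)\<close> is cut, in lexicographic order of the words
  \<open>w\<close> of length \<open>k\<close>, into intervals of length \<open>\<parallel>S\<^sub>w\<^sup>*f\<parallel>\<^sup>2\<close>; \<open>left_end w f\<close> is the left end of the
  interval of \<open>w\<close>, and \<open>code f t\<close> is the infinite word whose prefixes are the words of the
  intervals containing \<open>t\<close>.\<close>

fun left_end :: "nat list \<Rightarrow> 'h \<Rightarrow> real" where
  "left_end [] f = 0"
| "left_end (j # w) f = start f j + left_end w (S_adj j f)"

definition word_interval :: "nat list \<Rightarrow> 'h \<Rightarrow> real set" where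
  "word_interval w f = {left_end w f..<left_end w f + (norm (adj_word w f))\<^sup>2}"

text \<open>The half-open first-level intervals make the letter unique for \<open>t\<close> between
  0 and \<open>(norm f)\<^sup>2\<close>; outside this range the value is unspecified.\<close>

definition digit :: "'h \<Rightarrow> real \<Rightarrow> nat" where
  "digit f t = (THE j. j < N \<and> start f j \<le> t \<and> t < start f (Suc j))"

fun code :: "'h \<Rightarrow> real \<Rightarrow> nat \<Rightarrow> nat" where
  "code f t 0 = digit f t"
| "code f t (Suc n) = code (S_adj (digit f t) f) (t - start f (digit f t)) n"

lemma start_0 [simp]: "start f 0 = 0"
  by (simp add: start_def)

lemma start_Suc: "start f (Suc j) = start f j + (norm (S_adj j f))\<^sup>2"
  by (simp add: start_def)

lemma start_N: "start f N = (norm f)\<^sup>2"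
  by (simp add: start_def sum_norm_S_adj)

lemma start_mono: "i \<le> j \<Longrightarrow> start f i \<le> start f j"
  by (rule lift_Suc_mono_le[of "start f"]) (simp_all add: start_Suc)

lemma digit_unique:
  assumes "start f i \<le> t" "t < start f (Suc i)" "start f j \<le> t" "t < start f (Suc j)"
  shows "i = j"
proof (rule linorder_cases[of i j])
  assume "i < j"
  then show ?thesis using start_mono[of "Suc i" j f] assms by simp
next
  assume "j < i"
  then show ?thesis using start_mono[of "Suc j" i f] assms by simp
qed

lemma digit_eqI:
  assumes "j < N" "start f j \<le> t" "t < start f (Suc j)"
  shows "digit f t = j"
  unfolding digit_def using assms digit_unique by (intro the_equality) blast+

lemma digit:
  assumes "0 \<le> t" "t < (norm f)\<^sup>2"
  shows "digit f t < N" "start f (digit f t) \<le> t" "t < start f (Suc (digit f t))"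
proof -
  have "\<exists>j<n. start f j \<le> t \<and> t < start f (Suc j)" if "t < start f n" for n
    using that
  proof (induction n)
    case 0
    then show ?case using assms by simp
  next
    case (Suc n)
    then show ?case by (cases "t < start f n") (auto intro: less_SucI)
  qed
  from this[of N] assms obtain j where "j < N" "start f j \<le> t" "t < start f (Suc j)"
    by (auto simp: start_N)
  then show "digit f t < N" "start f (digit f t) \<le> t" "t < start f (Suc (digit f t))"
    using digit_eqI by metis+
qed

text \<open>The remainder is again an admissible parameter for the vector of the next stage, which
  keeps the recursion of \<open>code\<close> inside its range.\<close>

lemma digit_step:
  assumes "0 \<le> t" "t < (norm f)\<^sup>2"
  shows "0 \<le> t - start f (digit f t)" "t - start f (digit f t) < (norm (S_adj (digit f t) f))\<^sup>2"
  using digit[OF assms] by (simp_all add: start_Suc)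

lemma code_less: "0 \<le> t \<Longrightarrow> t < (norm f)\<^sup>2 \<Longrightarrow> code f t n < N"
proof (induction n arbitrary: f t)
  case (Suc n)
  then show ?case using digit_step by simp
qed (simp add: digit)

lemma word_interval_subset:
  assumes "set w \<subseteq> {..<N}"
  shows "0 \<le> left_end w f" "left_end w f + (norm (adj_word w f))\<^sup>2 \<le> (norm f)\<^sup>2"
  using assms
proof (induction w arbitrary: f)
  case Nil
  { case 1 then show ?case by simp }
  { case 2 then show ?case by simp }
next
  case (Cons j w)
  { case 1
    then show ?case using Cons(1)[of "S_adj j f"] start_mono[of 0 j f] by simp }
  { case 2
    then have "start f (Suc j) \<le> (norm f)\<^sup>2" using start_mono[of "Suc j" N f] by (simp add: start_N)
    then show ?case using 2 Cons(2)[of "S_adj j f"] by (simp add: start_Suc) }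
qed

text \<open>Induction on the word: removing the first letter \<open>j\<close> replaces
  \<open>f\<close> by \<open>S_adj j f\<close> and shifts all intervals by
  \<open>start f j\<close>.\<close>

lemma code_prefix_iff:
  assumes "set w \<subseteq> {..<N}" "0 \<le> t" "t < (norm f)\<^sup>2"
  shows "map (code f t) [0..<length w] = w \<longleftrightarrow> t \<in> word_interval w f"
  using assms
proof (induction w arbitrary: f t)
  case Nil
  then show ?case by (simp add: word_interval_def)
next
  case (Cons j w)
  let ?g = "S_adj j f" and ?s = "t - start f j"
  have map: "map (code f t) [0..<length (j # w)] =
      digit f t # map (code (S_adj (digit f t) f) (t - start f (digit f t))) [0..<length w]"
    by (simp add: map_upt_Suc del: upt_Suc)
  have shift: "t \<in> word_interval (j # w) f \<longleftrightarrow> ?s \<in> word_interval w ?g"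
    by (auto simp: word_interval_def)
  show ?case
  proof (cases "digit f t = j")
    case True
    then show ?thesis
      using Cons.IH[of ?s ?g] Cons.prems digit_step[OF Cons.prems(2,3)] unfolding map shift by simp
  next
    case False
    \<comment> \<open>Otherwise \<open>t\<close> would lie in the first-level interval of
      \<open>j\<close> and have \<open>j\<close> as its first digit.\<close>
    have "?s \<notin> word_interval w ?g"
    proof
      assume "?s \<in> word_interval w ?g"
      then have "0 \<le> ?s" "?s < (norm ?g)\<^sup>2"
        using word_interval_subset[of w ?g] Cons.prems by (auto simp: word_interval_def)
      then have "digit f t = j" using Cons.prems by (intro digit_eqI) (auto simp: start_Suc)
      with False show False by simp
    qed
    with False show ?thesis unfolding map shift by simp
  qed
qed

section \<open>The coding map into the space and the image of Lebesgue measure\<close>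

definition point :: "'h \<Rightarrow> real \<Rightarrow> 'x" where
  "point f t = (SOME x. \<forall>k. x \<in> cyl (map (code f t) [0..<k]))"

lemma point_in_prefix:
  assumes "0 \<le> t" "t < (norm f)\<^sup>2"
  shows "point f t \<in> cyl (map (code f t) [0..<k])"
  using someI_ex[OF address_point_exists[of "code f t"]] code_less[OF assms]
  unfolding point_def by blast

lemma point_in_limit_set:
  assumes "0 \<le> t" "t < (norm f)\<^sup>2"
  shows "point f t \<in> limit_set"
  unfolding limit_set_def
proof (intro INT_I UN_I)
  show "map (code f t) [0..<k] \<in> words k" for k
    using code_less[OF assms] by (auto simp: words_def)
qed (rule point_in_prefix[OF assms])

text \<open>By non-overlap the only word of its length whose cylinder contains the point is the
  corresponding prefix of the code.\<close>

lemma point_in_cyl_iff: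
  assumes w: "set w \<subseteq> {..<N}" and t: "0 \<le> t" "t < (norm f)\<^sup>2"
  shows "point f t \<in> cyl w \<longleftrightarrow> t \<in> word_interval w f"
proof -
  have "point f t \<in> cyl w \<longleftrightarrow> map (code f t) [0..<length w] = w"
    using point_in_prefix[OF t, of "length w"] code_less[OF t] w
      cyl_eq_words[of "map (code f t) [0..<length w]" "length w" w "point f t"]
    by (auto simp: words_def)
  then show ?thesis using code_prefix_iff[OF w t] by simp
qed

definition cyl_measure :: "'h \<Rightarrow> 'x measure" where
  "cyl_measure f = distr (restrict_space lborel {0..<(norm f)\<^sup>2}) borel (point f)"

text \<open>The preimage of an open set is a countable union of intervals: by completeness some
  prefix cylinder of each of its points is already inside the open set.\<close>

lemma measurable_point: "point f \<in> borel_measurable (restrict_space lborel {0..<(norm f)\<^sup>2})"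
proof (rule borel_measurableI)
  fix U :: "'x set" assume U: "open U"
  let ?I = "{0..<(norm f)\<^sup>2}"
  let ?W = "{w. set w \<subseteq> {..<N} \<and> cyl w \<subseteq> U}"
  have "point f -` U \<inter> ?I = (\<Union>w\<in>?W. word_interval w f)"
  proof
    show "(\<Union>w\<in>?W. word_interval w f) \<subseteq> point f -` U \<inter> ?I"
    proof
      fix t assume "t \<in> (\<Union>w\<in>?W. word_interval w f)"
      then obtain w where w: "set w \<subseteq> {..<N}" "cyl w \<subseteq> U" "t \<in> word_interval w f" by auto
      then have "0 \<le> t" "t < (norm f)\<^sup>2"
        using word_interval_subset[OF w(1), of f] by (auto simp: word_interval_def)
      then show "t \<in> point f -` U \<inter> ?I" using point_in_cyl_iff[OF w(1)] w by auto
    qed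
    show "point f -` U \<inter> ?I \<subseteq> (\<Union>w\<in>?W. word_interval w f)"
    proof
      fix t assume "t \<in> point f -` U \<inter> ?I"
      then have t: "0 \<le> t" "t < (norm f)\<^sup>2" "point f t \<in> U" by auto
      obtain k where "cyl (map (code f t) [0..<k]) \<subseteq> U"
        using small_cyl[OF code_less[OF t(1,2)] point_in_prefix[OF t(1,2)] U t(3)] by blast
      then have k: "map (code f t) [0..<k] \<in> ?W" using code_less[OF t(1,2)] by auto
      then have "t \<in> word_interval (map (code f t) [0..<k]) f"
        using point_in_cyl_iff[OF _ t(1,2)] point_in_prefix[OF t(1,2)] by blast
      with k show "t \<in> (\<Union>w\<in>?W. word_interval w f)" by blast
    qed
  qed
  moreover have "(\<Union>w\<in>?W. word_interval w f) \<in> sets lborel"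
    by (intro sets.countable_UN'') (auto simp: word_interval_def)
  moreover have "point f -` U \<inter> ?I \<subseteq> ?I" by simp
  ultimately show "point f -` U \<inter> space (restrict_space lborel ?I) \<in> sets (restrict_space lborel ?I)"
    by (simp add: sets_restrict_space_iff space_restrict_space)
qed

lemma sets_cyl_measure [simp]: "sets (cyl_measure f) = sets borel"
  by (simp add: cyl_measure_def)

lemma emeasure_cyl_measure:
  assumes "E \<in> sets borel"
  shows "emeasure (cyl_measure f) E = emeasure lborel (point f -` E \<inter> {0..<(norm f)\<^sup>2})"
  using assms measurable_point unfolding cyl_measure_def
  by (simp add: emeasure_distr emeasure_restrict_space space_restrict_space)

lemma cyl_measure_cyl:
  assumes w: "set w \<subseteq> {..<N}"
  shows "emeasure (cyl_measure f) (cyl w) = ennreal ((norm (adj_word w f))\<^sup>2)"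
proof -
  have "point f -` cyl w \<inter> {0..<(norm f)\<^sup>2} = word_interval w f"
    using point_in_cyl_iff[OF w] word_interval_subset[OF w, of f] by (auto simp: word_interval_def)
  then show ?thesis
    using w by (simp add: emeasure_cyl_measure cyl_borel word_interval_def)
qed

lemma cyl_measure_null:
  assumes "E \<in> sets borel" "E \<inter> limit_set = {}"
  shows "emeasure (cyl_measure f) E = 0"
proof -
  have "point f -` E \<inter> {0..<(norm f)\<^sup>2} = {}"
    using point_in_limit_set assms by auto
  then show ?thesis using assms by (simp add: emeasure_cyl_measure)
qed

lemma cyl_measure_UNIV: "emeasure (cyl_measure f) UNIV = ennreal ((norm f)\<^sup>2)"
  using cyl_measure_cyl[of "[]" f] by simp

lemma finite_cyl_measure: "finite_measure (cyl_measure f)"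
  by (rule finite_measureI) (simp add: cyl_measure_def cyl_measure_UNIV[unfolded cyl_measure_def])

end

section \<open>Projection valued measures\<close>

lemma pvm_orth_projection: "pvm P \<Longrightarrow> E \<in> sets borel \<Longrightarrow> orth_projection (P E)"
  by (simp add: pvm_def)

lemma pvm_sums:
  "pvm P \<Longrightarrow> range F \<subseteq> sets borel \<Longrightarrow> disjoint_family F \<Longrightarrow> (\<lambda>n. P (F n) f) sums P (\<Union>n. F n) f"
  by (simp add: pvm_def)

lemma pvm_UNIV: "pvm P \<Longrightarrow> P UNIV = id"
  by (simp add: pvm_def)

text \<open>The constant family of empty sets is disjoint, and a constant series converges only if
  its terms vanish.\<close>

lemma pvm_empty:
  assumes "pvm P"
  shows "P {} f = 0"
proof -
  have "(\<lambda>n::nat. P {} f) sums P {} f"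
    using pvm_sums[OF assms, of "\<lambda>_. {}" f] by (simp add: disjoint_family_on_def)
  then have "summable (\<lambda>n::nat. P {} f)" by (rule sums_summable)
  then show ?thesis by (simp add: summable_const_iff)
qed

text \<open>Strong convergence paired with \<open>f\<close> gives convergence of the quadratic
  forms, which for projections are squared norms.\<close>

lemma pvm_norm_sums:
  assumes P: "pvm P" and F: "range F \<subseteq> sets borel" "disjoint_family F"
  shows "(\<lambda>n. (norm (P (F n) f))\<^sup>2) sums (norm (P (\<Union>n. F n) f))\<^sup>2"
proof -
  have F': "F n \<in> sets borel" "(\<Union>n. F n) \<in> sets borel" for n using F by auto
  have "(\<lambda>n. \<Sum>i<n. complex_of_real ((norm (P (F i) f))\<^sup>2)) \<longlonglongrightarrow> complex_of_real ((norm (P (\<Union>n. F n) f))\<^sup>2)"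
    unfolding orth_projection_cinner[OF pvm_orth_projection[OF P F'(1)], symmetric]
      orth_projection_cinner[OF pvm_orth_projection[OF P F'(2)], symmetric] cinner_sum_right[symmetric]
    using pvm_sums[OF P F, of f] by (intro tendsto_cinner tendsto_const) (simp add: sums_def)
  then show ?thesis
    unfolding sums_def of_real_sum[symmetric] by (rule tendsto_of_real_iff[THEN iffD1])
qed

lemma sets_pvm_measure [simp]: "sets (pvm_measure P f) = sets borel"
  unfolding pvm_measure_def using sets.sigma_sets_eq[of borel] by (simp add: sets_measure_of_conv)

lemma space_pvm_measure [simp]: "space (pvm_measure P f) = UNIV"
  by (simp add: pvm_measure_def space_measure_of_conv)

text \<open>\<open>measure_of\<close> returns the given values only after positivity and countable
  additivity have been verified.\<close>

lemma emeasure_pvm_measure: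
  assumes P: "pvm P" and E: "E \<in> sets borel"
  shows "emeasure (pvm_measure P f) E = ennreal ((norm (P E f))\<^sup>2)"
  unfolding pvm_measure_def
proof (rule emeasure_measure_of_sigma[OF _ _ _ E])
  show "sigma_algebra UNIV (sets (borel :: 'a measure))"
    using sets.sigma_algebra_axioms[of "borel :: 'a measure"] by simp
  show "positive (sets borel) (\<lambda>E. ennreal ((norm (P E f))\<^sup>2))"
    by (simp add: positive_def pvm_empty[OF P])
  show "countably_additive (sets borel) (\<lambda>E. ennreal ((norm (P E f))\<^sup>2))"
    unfolding countably_additive_def
    by (intro allI impI suminf_ennreal_eq pvm_norm_sums[OF P]) simp_all
qed

lemma finite_pvm_measure: "pvm P \<Longrightarrow> finite_measure (pvm_measure P f)"
  by (rule finite_measureI) (simp add: emeasure_pvm_measure)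

lemma measure_pvm_measure:
  "pvm P \<Longrightarrow> E \<in> sets borel \<Longrightarrow> measure (pvm_measure P f) E = (norm (P E f))\<^sup>2"
  by (simp add: measure_def emeasure_pvm_measure)

lemma pvm_eq_zero_iff:
  "pvm P \<Longrightarrow> E \<in> sets borel \<Longrightarrow> P E f = 0 \<longleftrightarrow> E \<in> null_sets (pvm_measure P f)"
  by (simp add: null_sets_def emeasure_pvm_measure)

text \<open>Both sides are projections whose squared norms at \<open>f\<close> are
  \<open>(norm f)\<^sup>2\<close> minus that of \<open>P E f\<close>: on the left by additivity of
  the scalar measure, on the right by Pythagoras.\<close>

lemma pvm_compl:
  assumes P: "pvm P" and E: "E \<in> sets borel"
  shows "P (- E) f = f - P E f"
proof -
  have "norm (P (- E) f) = norm (f - P E f)" for f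
  proof -
    interpret finite_measure "pvm_measure P f" by (rule finite_pvm_measure[OF P])
    have "(norm (P (- E) f))\<^sup>2 = (norm f)\<^sup>2 - (norm (P E f))\<^sup>2"
      using finite_measure_compl[of E] E
      by (simp add: measure_pvm_measure[OF P] pvm_UNIV[OF P] Compl_eq_Diff_UNIV)
    then have "(norm (P (- E) f))\<^sup>2 = (norm (f - P E f))\<^sup>2"
      by (simp add: orth_projection_pythagoras[OF pvm_orth_projection[OF P E]])
    then show ?thesis by (simp add: power2_eq_iff_nonneg)
  qed
  then have "P (- E) = (\<lambda>f. f - P E f)"
    using E by (intro orth_projection_eqI orth_projection_compl pvm_orth_projection[OF P]) auto
  then show ?thesis by simp
qed

lemma pvm_integral_one:
  assumes P: "pvm P"
  shows "pvm_integral P (\<lambda>_. 1) = id"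
  unfolding pvm_integral_def
proof (rule the_equality)
  note int = measure_pvm_measure[OF P] pvm_UNIV[OF P] cinner_self scaleR_conv_of_real
  show "bounded_clinear (id::'b \<Rightarrow> 'b) \<and> (\<forall>f. cinner f (id f) = (\<integral>x. 1 \<partial>pvm_measure P f))"
    by (simp add: bounded_clinear_id int)
  show "T = id" if "bounded_clinear T \<and> (\<forall>f. cinner f (T f) = (\<integral>x. 1 \<partial>pvm_measure P f))" for T
    using that by (intro cinner_quadratic_eqI bounded_clinear_id) (simp_all add: int)
qed

section \<open>Uniqueness, existence and self-similarity of the measure\<close>

context cuntz_ifs
begin

lemma words_Suc: "words (Suc k) = (\<lambda>(j, w). j # w) ` ({..<N} \<times> words k)"
  by (auto simp: words_def image_iff length_Suc_conv)

lemma sum_norm_adj_word: "(\<Sum>w\<in>words k. (norm (adj_word w f))\<^sup>2) = (norm f)\<^sup>2"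
proof (induction k arbitrary: f)
  case 0
  have "words 0 = {[]}" by (auto simp: words_def)
  then show ?case by simp
next
  case (Suc k)
  have "(\<Sum>w\<in>words (Suc k). (norm (adj_word w f))\<^sup>2) =
      (\<Sum>(j, w)\<in>{..<N} \<times> words k. (norm (adj_word w (S_adj j f)))\<^sup>2)"
    unfolding words_Suc by (subst sum.reindex) (auto simp: inj_on_def case_prod_unfold)
  also have "\<dots> = (norm f)\<^sup>2"
    by (simp add: sum.cartesian_product[symmetric] Suc sum_norm_S_adj)
  finally show ?case .
qed

text \<open>Unlike the prescribed values, this includes the empty word, where the condition reads
  \<open>P UNIV = id\<close>; inductions over words can then start there.\<close>

definition cyl_pvm :: "('x set \<Rightarrow> 'h \<Rightarrow> 'h) \<Rightarrow> bool" where
  "cyl_pvm P \<longleftrightarrow> pvm P \<and> (\<forall>w. set w \<subseteq> {..<N} \<longrightarrow> P (cyl w) = word_projection w)"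

lemma cyl_pvm_iff: "cyl_pvm P \<longleftrightarrow> pvm P \<and> extends_cylinder_projections N S \<sigma> P"
proof
  assume "cyl_pvm P"
  then show "pvm P \<and> extends_cylinder_projections N S \<sigma> P"
    by (simp add: cyl_pvm_def extends_cylinder_projections_def word_projection_def adj_word_def)
next
  assume P: "pvm P \<and> extends_cylinder_projections N S \<sigma> P"
  have "P (cyl w) = word_projection w" if "set w \<subseteq> {..<N}" for w
  proof (cases "w = []")
    case True
    then show ?thesis using P by (simp add: pvm_UNIV word_projection_def o_def id_def)
  next
    case False
    then show ?thesis
      using P that by (simp add: extends_cylinder_projections_def word_projection_def adj_word_def)
  qed
  then show "cyl_pvm P" using P by (simp add: cyl_pvm_def)
qed

lemma cyl_pvmD:
  assumes "cyl_pvm P"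
  shows "pvm P" "set w \<subseteq> {..<N} \<Longrightarrow> P (cyl w) = word_projection w"
  using assms by (auto simp: cyl_pvm_def)

text \<open>The disjoint cylinders of length \<open>k\<close> together carry the full mass
  \<open>(norm f)\<^sup>2\<close>.\<close>

lemma cyl_pvm_level_null:
  assumes P: "cyl_pvm P"
  shows "- (\<Union>w\<in>words k. cyl w) \<in> null_sets (pvm_measure P f)"
proof -
  note pvm = cyl_pvmD(1)[OF P]
  let ?U = "\<Union>w\<in>words k. cyl w"
  interpret finite_measure "pvm_measure P f" by (rule finite_pvm_measure[OF pvm])
  have cb: "w \<in> words k \<Longrightarrow> cyl w \<in> sets borel" for w by (auto simp: words_def intro: cyl_borel)
  have U: "?U \<in> sets borel" by (intro sets.finite_UN finite_words cb)
  have "measure (pvm_measure P f) ?U = (\<Sum>w\<in>words k. measure (pvm_measure P f) (cyl w))"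
    using cb cyl_eq_words
    by (intro finite_measure_finite_Union finite_words) (auto simp: disjoint_family_on_def)
  also have "\<dots> = (\<Sum>w\<in>words k. (norm (adj_word w f))\<^sup>2)"
    by (intro sum.cong refl)
      (auto simp: measure_pvm_measure[OF pvm] cb words_def cyl_borel cyl_pvmD(2)[OF P] norm_word_projection)
  also have "\<dots> = measure (pvm_measure P f) (space (pvm_measure P f))"
    by (simp add: sum_norm_adj_word measure_pvm_measure[OF pvm] pvm_UNIV[OF pvm])
  finally have "measure (pvm_measure P f) (- ?U) = 0"
    using finite_measure_compl[of ?U] U by (simp add: Compl_eq_Diff_UNIV)
  moreover have "- ?U \<in> sets borel" using U by (rule borel_comp)
  ultimately show ?thesis by (simp add: null_sets_def emeasure_eq_measure del: Compl_UN)
qed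

text \<open>The complement of the limit set is a countable union of the null sets left over at each
  level.\<close>

lemma cyl_pvm_null:
  assumes P: "cyl_pvm P" and E: "E \<in> sets borel" "E \<inter> limit_set = {}"
  shows "P E f = 0"
proof -
  have "(\<Union>k. - (\<Union>w\<in>words k. cyl w)) \<in> null_sets (pvm_measure P f)"
    by (intro null_sets_UN cyl_pvm_level_null[OF P])
  moreover have "E \<subseteq> (\<Union>k. - (\<Union>w\<in>words k. cyl w))"
    using E(2) by (auto simp: limit_set_def)
  ultimately have "E \<in> null_sets (pvm_measure P f)"
    using E(1) by (elim null_sets_subset) simp_all
  then show ?thesis using pvm_eq_zero_iff[OF cyl_pvmD(1)[OF P] E(1)] by simp
qed

lemma cyl_pvm_unique:
  assumes P: "cyl_pvm P" and Q: "cyl_pvm Q" and "E \<in> sets borel"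
  shows "P E = Q E"
  using \<open>E \<in> sets borel\<close>
proof (induction rule: borel_cylinder_induct)
  case (null E)
  then show ?case by (intro ext) (simp add: cyl_pvm_null[OF P] cyl_pvm_null[OF Q])
next
  case (cylinder w)
  then show ?case by (simp add: cyl_pvmD[OF P] cyl_pvmD[OF Q])
next
  case (compl E)
  then show ?case
    by (intro ext) (simp add: pvm_compl[OF cyl_pvmD(1)[OF P]] pvm_compl[OF cyl_pvmD(1)[OF Q]])
next
  case (union F)
  show ?case
  proof
    fix f
    show "P (\<Union>n. F n) f = Q (\<Union>n. F n) f"
      using pvm_sums[OF cyl_pvmD(1)[OF P] union(1,2), of f]
        pvm_sums[OF cyl_pvmD(1)[OF Q] union(1,2), of f] unfolding union(3)
      by (rule sums_unique2)
  qed
qed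

lemma cyl_projection_exists:
  assumes "E \<in> sets borel"
  shows "\<exists>T. orth_projection T \<and> (\<forall>f. (norm (T f))\<^sup>2 = measure (cyl_measure f) E)"
  using assms
proof (induction rule: borel_cylinder_induct)
  case (null E)
  then show ?case by (intro exI[of _ "\<lambda>_. 0"]) (simp add: orth_projection_zero measure_def cyl_measure_null)
next
  case (cylinder w)
  then show ?case
    by (intro exI[of _ "word_projection w"])
      (simp add: orth_projection_word measure_def cyl_measure_cyl norm_word_projection)
next
  case (compl E)
  then obtain T where T: "orth_projection T" "\<And>f. (norm (T f))\<^sup>2 = measure (cyl_measure f) E" by blast
  have "(norm (f - T f))\<^sup>2 = measure (cyl_measure f) (- E)" for f
  proof -
    interpret finite_measure "cyl_measure f" by (rule finite_cyl_measure)
    have "space (cyl_measure f) = UNIV" by (simp add: cyl_measure_def)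
    then show ?thesis
      using finite_measure_compl[of E] compl(1) cyl_measure_UNIV[of f]
      by (simp add: orth_projection_pythagoras[OF T(1)] T(2) Compl_eq_Diff_UNIV measure_def[of _ UNIV])
  qed
  then show ?case using orth_projection_compl[OF T(1)] by blast
next
  case (union F)
  then obtain T where T: "\<And>n. orth_projection (T n)"
      "\<And>n f. (norm (T n f))\<^sup>2 = measure (cyl_measure f) (F n)" by metis
  \<comment> \<open>Disjoint sets have total mass at most \<open>(norm f)\<^sup>2\<close>, which
    forces orthogonality.\<close>
  have orth: "T m (T n f) = 0" if "m \<noteq> n" for m n f
  proof (rule orth_projection_mult_zero[OF T(1) T(1)])
    fix f
    interpret finite_measure "cyl_measure f" by (rule finite_cyl_measure)
    have "F m \<inter> F n = {}" using union(2) that by (auto simp: disjoint_family_on_def)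
    then have "(norm (T m f))\<^sup>2 + (norm (T n f))\<^sup>2 = measure (cyl_measure f) (F m \<union> F n)"
      using union(1) unfolding T(2) by (intro finite_measure_Union[symmetric]) auto
    also have "\<dots> \<le> measure (cyl_measure f) UNIV"
      by (intro finite_measure_mono) auto
    also have "\<dots> = (norm f)\<^sup>2" by (simp add: measure_def cyl_measure_UNIV)
    finally show "(norm (T m f))\<^sup>2 + (norm (T n f))\<^sup>2 \<le> (norm f)\<^sup>2" .
  qed
  obtain U where U: "orth_projection U" "\<And>f. (\<lambda>n. T n f) sums U f"
      "\<And>f. (\<lambda>n. (norm (T n f))\<^sup>2) sums (norm (U f))\<^sup>2"
    using orth_projection_sums[of T, OF T(1) orth] by blast
  have "(norm (U f))\<^sup>2 = measure (cyl_measure f) (\<Union>n. F n)" for f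
  proof -
    interpret finite_measure "cyl_measure f" by (rule finite_cyl_measure)
    show ?thesis
      using U(3)[of f] finite_measure_UNION[of F] union(1,2) unfolding T(2)
      by (intro sums_unique2[of "\<lambda>n. measure (cyl_measure f) (F n)"]) auto
  qed
  with U(1) show ?case by blast
qed

lemma cyl_pvm_exists: "\<exists>P\<in>extensional (sets borel). cyl_pvm P"
proof -
  obtain P0 where P0: "\<And>E. E \<in> sets borel \<Longrightarrow> orth_projection (P0 E)"
      "\<And>E f. E \<in> sets borel \<Longrightarrow> (norm (P0 E f))\<^sup>2 = measure (cyl_measure f) E"
    using cyl_projection_exists by metis
  \<comment> \<open>Restriction fixes the values off the Borel sets, so that uniqueness can mean
    equality of functions.\<close>
  define P where "P = restrict P0 (sets borel)"
  have P: "orth_projection (P E)" "(norm (P E f))\<^sup>2 = measure (cyl_measure f) E" if "E \<in> sets borel" for E f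
    using P0[OF that] that by (simp_all add: P_def)
  \<comment> \<open>Each value of \<open>P\<close> is identified by its norms alone; this serves
    both the cylinders and the countable unions.\<close>
  have eqI: "P E = T" if "E \<in> sets borel" "orth_projection T"
      "\<And>f. (norm (T f))\<^sup>2 = measure (cyl_measure f) E" for E T
  proof (rule orth_projection_eqI[OF P(1)[OF that(1)] that(2)])
    fix f
    have "(norm (P E f))\<^sup>2 = (norm (T f))\<^sup>2" using P(2)[OF that(1)] that(3) by simp
    then show "norm (P E f) = norm (T f)" by (simp add: power2_eq_iff_nonneg)
  qed
  have disj: "P E (P F f) = 0" if "E \<in> sets borel" "F \<in> sets borel" "E \<inter> F = {}" for E F f
  proof (rule orth_projection_mult_zero[OF P(1)[OF that(1)] P(1)[OF that(2)]])
    fix f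
    interpret finite_measure "cyl_measure f" by (rule finite_cyl_measure)
    have "(norm (P E f))\<^sup>2 + (norm (P F f))\<^sup>2 = measure (cyl_measure f) (E \<union> F)"
      using that by (simp add: P(2) finite_measure_Union)
    also have "\<dots> \<le> measure (cyl_measure f) UNIV"
      by (intro finite_measure_mono) auto
    also have "\<dots> = (norm f)\<^sup>2" by (simp add: measure_def cyl_measure_UNIV)
    finally show "(norm (P E f))\<^sup>2 + (norm (P F f))\<^sup>2 \<le> (norm f)\<^sup>2" .
  qed
  have cyl: "P (cyl w) = word_projection w" if "set w \<subseteq> {..<N}" for w
    using that by (intro eqI cyl_borel orth_projection_word)
      (simp_all add: measure_def cyl_measure_cyl norm_word_projection)
  have sums: "(\<lambda>n. P (F n) f) sums P (\<Union>n. F n) f"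
    if F: "range F \<subseteq> sets borel" "disjoint_family F" for F and f
  proof -
    have F': "F n \<in> sets borel" for n using F by auto
    have "P (F m) (P (F n) f) = 0" if "m \<noteq> n" for m n f
      using F(2) that by (intro disj F') (auto simp: disjoint_family_on_def)
    then obtain U where U: "orth_projection U" "\<And>f. (\<lambda>n. P (F n) f) sums U f"
        "\<And>f. (\<lambda>n. (norm (P (F n) f))\<^sup>2) sums (norm (U f))\<^sup>2"
      using orth_projection_sums[of "\<lambda>n. P (F n)", OF P(1)[OF F']] by blast
    have "P (\<Union>n. F n) = U"
    proof (rule eqI[OF _ U(1)])
      fix f
      interpret finite_measure "cyl_measure f" by (rule finite_cyl_measure)
      show "(norm (U f))\<^sup>2 = measure (cyl_measure f) (\<Union>n. F n)"
        using U(3)[of f] finite_measure_UNION[of F] F unfolding P(2)[OF F']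
        by (intro sums_unique2[of "\<lambda>n. measure (cyl_measure f) (F n)"]) auto
    qed (use F' in auto)
    with U(2) show ?thesis by simp
  qed
  have "P UNIV = id" using cyl[of "[]"] by (simp add: word_projection_def)
  then have "pvm P"
    using P(1) disj sums by (simp add: pvm_def fun_eq_iff)
  with cyl have "cyl_pvm P" by (simp add: cyl_pvm_def)
  moreover have "P \<in> extensional (sets borel)" by (simp add: P_def)
  ultimately show ?thesis by blast
qed

text \<open>On a cylinder only the summand of its first letter survives, and it rebuilds the word
  projection. Complements use that the \<open>S j (S_adj j f)\<close> sum to \<open>f\<close>, and
  disjoint unions use continuity of the \<open>S j\<close>.\<close>

lemma cyl_pvm_self_similar:
  assumes P: "cyl_pvm P" and "E \<in> sets borel"
  shows "(\<Sum>j<N. S j (P (\<sigma> j -` E) (S_adj j f))) = P E f"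
  using \<open>E \<in> sets borel\<close>
proof (induction arbitrary: f rule: borel_cylinder_induct)
  case (null E)
  have "S j (P (\<sigma> j -` E) (S_adj j f)) = 0" if "j < N" for j
    using that null by (simp add: cyl_pvm_null[OF P] vimage_sigma_borel vimage_sigma_limit_set
      bounded_clinearD(5)[OF bounded_clinear_S])
  then show ?case using null by (simp add: cyl_pvm_null[OF P])
next
  case (cylinder w)
  show ?case
  proof (cases w)
    case Nil
    then show ?thesis by (simp add: pvm_UNIV[OF cyl_pvmD(1)[OF P]] sum_S_S_adj)
  next
    case (Cons i v)
    have "S j (P (\<sigma> j -` cyl (i # v)) (S_adj j f)) = (if i = j then S i (word_projection v (S_adj i f)) else 0)"
      if "j < N" for j
      using that cylinder Cons
      by (simp add: vimage_sigma_cyl cyl_pvmD[OF P] pvm_empty[OF cyl_pvmD(1)[OF P]]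
        bounded_clinearD(5)[OF bounded_clinear_S])
    then show ?thesis
      using cylinder Cons by (simp add: cyl_pvmD(2)[OF P] word_projection_def)
  qed
next
  case (compl E)
  have "S j (P (\<sigma> j -` (- E)) (S_adj j f)) = S j (S_adj j f) - S j (P (\<sigma> j -` E) (S_adj j f))"
    if "j < N" for j
    using that compl(1) by (simp add: vimage_Compl pvm_compl[OF cyl_pvmD(1)[OF P]] vimage_sigma_borel
      bounded_clinearD(4)[OF bounded_clinear_S])
  then show ?case
    using compl by (simp add: sum_subtractf sum_S_S_adj pvm_compl[OF cyl_pvmD(1)[OF P]])
next
  case (union F)
  have "(\<lambda>n. S j (P (\<sigma> j -` F n) (S_adj j f))) sums S j (P (\<sigma> j -` (\<Union>n. F n)) (S_adj j f))"
    if "j < N" for j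
  proof -
    have "(\<lambda>n. P (\<sigma> j -` F n) (S_adj j f)) sums P (\<Union>n. \<sigma> j -` F n) (S_adj j f)"
      using union(1,2) that
      by (intro pvm_sums[OF cyl_pvmD(1)[OF P]]) (auto simp: vimage_sigma_borel disjoint_family_on_def)
    from bounded_linear.sums[OF bounded_clinearD(1)[OF bounded_clinear_S[OF that]] this]
    show ?thesis by (simp add: vimage_UN)
  qed
  then have "(\<lambda>n. \<Sum>j<N. S j (P (\<sigma> j -` F n) (S_adj j f))) sums
      (\<Sum>j<N. S j (P (\<sigma> j -` (\<Union>n. F n)) (S_adj j f)))"
    by (intro sums_sum) auto
  then show ?case
    unfolding union(3) using pvm_sums[OF cyl_pvmD(1)[OF P] union(1,2), of f] by (rule sums_unique2)
qed

section \<open>Invariance of the scalar measures\<close>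

lemma pvm_measure_sigma:
  assumes P: "cyl_pvm P" and j: "j < N" and E: "E \<in> sets borel"
  shows "emeasure (pvm_measure P (S_adj j f)) (\<sigma> j -` E) = emeasure (pvm_measure P f) (E \<inter> cyl [j])"
proof -
  note pvm = cyl_pvmD(1)[OF P]
  have E': "E \<inter> cyl [j] \<in> sets borel" using E j by (auto intro!: cyl_borel)
  \<comment> \<open>In the self-similarity relation for \<open>E \<inter> cyl [j]\<close> all
    summands but that of \<open>j\<close> vanish; since \<open>S j\<close> is isometric, norms can
    then be compared.\<close>
  have "S i (P (\<sigma> i -` (E \<inter> cyl [j])) (S_adj i f)) = (if i = j then S j (P (\<sigma> j -` E) (S_adj j f)) else 0)"
    if "i < N" for i
    using that j by (simp add: vimage_sigma_cyl pvm_empty[OF pvm] bounded_clinearD(5)[OF bounded_clinear_S])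
  then have "P (E \<inter> cyl [j]) f = S j (P (\<sigma> j -` E) (S_adj j f))"
    using cyl_pvm_self_similar[OF P E', of f] j by simp
  then show ?thesis
    using E E' j by (simp add: emeasure_pvm_measure[OF pvm] vimage_sigma_borel norm_S)
qed

text \<open>The cylinders of the single letters partition the space up to a null set, so their
  indicators form a partition of unity almost everywhere.\<close>

lemma AE_first_level:
  assumes P: "cyl_pvm P"
  shows "AE x in pvm_measure P f. (\<Sum>j<N. indicator (cyl [j]) x) = (1::real)"
proof (rule AE_I'[OF cyl_pvm_level_null[OF P, of 1]])
  have "(\<Sum>j<N. indicator (cyl [j]) x) = (1::real)" if "w \<in> words 1" "x \<in> cyl w" for x w
  proof -
    have "length w = Suc 0" "set w \<subseteq> {..<N}" using that(1) by (simp_all add: words_def)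
    then obtain i where i: "w = [i]" "i < N" by (auto simp: length_Suc_conv)
    have "indicator (cyl [j]) x = (if i = j then 1 else 0::real)" if "j < N" for j
      using cyl_disjoint[of "[i]" "[j]"] \<open>x \<in> cyl w\<close> i that
      by (cases "i = j") (auto simp: indicator_def)
    then have "(\<Sum>j<N. indicator (cyl [j]) x) = (\<Sum>j<N. if i = j then 1 else 0::real)"
      by (intro sum.cong) auto
    then show ?thesis using i by simp
  qed
  then show "{x \<in> space (pvm_measure P f). (\<Sum>j<N. indicator (cyl [j]) x) \<noteq> (1::real)} \<subseteq>
      - (\<Union>w\<in>words 1. cyl w)" by auto
qed

lemma sum_emeasure_sigma:
  assumes P: "cyl_pvm P" and E: "E \<in> sets borel"
  shows "(\<Sum>j<N. emeasure (pvm_measure P (S_adj j f)) (\<sigma> j -` E)) = emeasure (pvm_measure P f) E"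
proof -
  have cb: "j < N \<Longrightarrow> cyl [j] \<in> sets borel" for j by (intro cyl_borel) auto
  have "(\<Sum>j<N. emeasure (pvm_measure P (S_adj j f)) (\<sigma> j -` E)) =
      (\<Sum>j<N. emeasure (pvm_measure P f) (E \<inter> cyl [j]))"
    by (rule sum.cong) (simp_all add: pvm_measure_sigma[OF P _ E])
  also have "\<dots> = emeasure (pvm_measure P f) (\<Union>j<N. E \<inter> cyl [j])"
  proof (rule sum_emeasure)
    show "disjoint_family_on (\<lambda>j. E \<inter> cyl [j]) {..<N}"
      unfolding disjoint_family_on_def
    proof (intro ballI impI)
      fix i j assume "i \<in> {..<N}" "j \<in> {..<N}" "i \<noteq> j"
      then have "cyl [i] \<inter> cyl [j] = {}" by (intro cyl_disjoint) auto
      then show "(E \<inter> cyl [i]) \<inter> (E \<inter> cyl [j]) = {}" by blast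
    qed
  qed (use E cb in auto)
  also have "\<dots> = emeasure (pvm_measure P f) E"
  proof (rule emeasure_eq_AE)
    show "AE x in pvm_measure P f. (x \<in> (\<Union>j<N. E \<inter> cyl [j])) = (x \<in> E)"
      using AE_first_level[OF P, of f]
    proof eventually_elim
      case (elim x)
      then have "\<not> (\<forall>j\<in>{..<N}. indicator (cyl [j]) x = (0::real))"
        using sum.neutral[of "{..<N}" "\<lambda>j. indicator (cyl [j]) x :: real"] by linarith
      then show ?case by (auto simp: indicator_def split: if_splits)
    qed
  qed (use E cb in auto)
  finally show ?thesis .
qed

text \<open>The image under \<open>\<sigma> j\<close> of the scalar measure of
  \<open>S_adj j f\<close> is that of \<open>f\<close> restricted to \<open>cyl [j]\<close>, written
  as a density; the restrictions add up by the almost everywhere partition of unity.\<close>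

lemma sum_integral_sigma:
  fixes \<psi> :: "'x \<Rightarrow> complex"
  assumes P: "cyl_pvm P" and \<psi>: "\<psi> \<in> borel_measurable borel" "bounded (range \<psi>)"
  shows "(\<Sum>j<N. \<integral>x. \<psi> (\<sigma> j x) \<partial>pvm_measure P (S_adj j f)) = (\<integral>x. \<psi> x \<partial>pvm_measure P f)"
proof -
  let ?M = "pvm_measure P f"
  interpret finite_measure ?M by (rule finite_pvm_measure[OF cyl_pvmD(1)[OF P]])
  have meas: "borel_measurable (pvm_measure P g) = borel_measurable borel"
    "measurable (pvm_measure P g) borel = measurable borel (borel :: 'x measure)" for g
    by (intro measurable_cong_sets; simp)+
  have cb: "j < N \<Longrightarrow> cyl [j] \<in> sets borel" for j by (intro cyl_borel) auto
  obtain B where "\<And>x. norm (\<psi> x) \<le> B" using \<psi>(2) by (auto simp: bounded_iff)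
  then have int: "integrable ?M \<psi>"
    using \<psi>(1) by (intro integrable_const_bound[where B = B]) (auto simp: meas)
  have "(\<integral>x. \<psi> (\<sigma> j x) \<partial>pvm_measure P (S_adj j f)) = (\<integral>x. indicator (cyl [j]) x *\<^sub>R \<psi> x \<partial>?M)"
    if j: "j < N" for j
  proof -
    have "distr (pvm_measure P (S_adj j f)) borel (\<sigma> j) = density ?M (\<lambda>x. ennreal (indicator (cyl [j]) x))"
    proof (rule measure_eqI)
      fix E assume "E \<in> sets (distr (pvm_measure P (S_adj j f)) borel (\<sigma> j))"
      then have E: "E \<in> sets borel" by simp
      have "emeasure (distr (pvm_measure P (S_adj j f)) borel (\<sigma> j)) E = emeasure ?M (E \<inter> cyl [j])"
        using E measurable_sigma[OF j] by (simp add: emeasure_distr meas pvm_measure_sigma[OF P j E])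
      also have "\<dots> = emeasure (density ?M (indicator (cyl [j]))) E"
        using E cb[OF j] by (simp add: emeasure_restricted Int_commute)
      finally show "emeasure (distr (pvm_measure P (S_adj j f)) borel (\<sigma> j)) E =
          emeasure (density ?M (\<lambda>x. ennreal (indicator (cyl [j]) x))) E"
        by (simp add: ennreal_indicator)
    qed simp
    moreover have "(\<integral>x. \<psi> (\<sigma> j x) \<partial>pvm_measure P (S_adj j f)) =
        (\<integral>x. \<psi> x \<partial>distr (pvm_measure P (S_adj j f)) borel (\<sigma> j))"
      using measurable_sigma[OF j] \<psi>(1) by (intro integral_distr[symmetric]) (auto simp: meas)
    ultimately show ?thesis
      using cb[OF j] \<psi>(1) by (simp add: integral_density meas)
  qed
  then have "(\<Sum>j<N. \<integral>x. \<psi> (\<sigma> j x) \<partial>pvm_measure P (S_adj j f)) =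
      (\<Sum>j<N. \<integral>x. indicator (cyl [j]) x *\<^sub>R \<psi> x \<partial>?M)" by simp
  also have "\<dots> = (\<integral>x. (\<Sum>j<N. indicator (cyl [j]) x *\<^sub>R \<psi> x) \<partial>?M)"
    using int cb by (intro Bochner_Integration.integral_sum[symmetric] integrable_mult_indicator) auto
  also have "\<dots> = (\<integral>x. \<psi> x \<partial>?M)"
  proof (rule integral_cong_AE)
    show "AE x in ?M. (\<Sum>j<N. indicator (cyl [j]) x *\<^sub>R \<psi> x) = \<psi> x"
      using AE_first_level[OF P, of f]
      by eventually_elim (simp add: scaleR_sum_left[symmetric] del: scaleR_sum_left)
    show "(\<lambda>x. \<Sum>j<N. indicator (cyl [j]) x *\<^sub>R \<psi> x) \<in> borel_measurable ?M"
      using \<psi>(1) cb unfolding meas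
      by (intro borel_measurable_sum borel_measurable_scaleR borel_measurable_indicator) auto
    show "\<psi> \<in> borel_measurable ?M" using \<psi>(1) by (simp add: meas)
  qed
  finally show ?thesis .
qed

end

theorem theorem2p2:
  fixes N :: nat
    and S :: "nat \<Rightarrow> 'h::complex_hilbert \<Rightarrow> 'h"
    and \<sigma> :: "nat \<Rightarrow> 'x::metric_space \<Rightarrow> 'x"
  assumes "N \<ge> 2"
    and "cuntz_representation N S"
    and "compact (UNIV :: 'x set)"
    and "ifs N \<sigma>"
    and "complete_ifs N \<sigma>"
    and "non_overlapping_ifs N \<sigma>"
  shows
    "(\<exists>!P. P \<in> extensional (sets borel) \<and> pvm P \<and> extends_cylinder_projections N S \<sigma> P) \<and>
     (\<forall>P. pvm P \<and> extends_cylinder_projections N S \<sigma> P \<longrightarrow>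
        (\<forall>E\<in>sets borel. P E = cadjoint (P E) \<and> P E = P E \<circ> P E) \<and>
        pvm_integral P (\<lambda>_. 1) = id \<and>
        (\<forall>E\<in>sets borel. \<forall>F\<in>sets borel. E \<inter> F = {} \<longrightarrow> P E \<circ> P F = (\<lambda>_. 0)) \<and>
        (\<forall>E\<in>sets borel. (\<lambda>f. \<Sum>j<N. (S j \<circ> P (\<sigma> j -` E) \<circ> cadjoint (S j)) f) = P E) \<and>
        (\<forall>f. \<forall>E\<in>sets borel. emeasure (pvm_measure P f) E = ennreal ((norm (P E f))\<^sup>2)) \<and>
        (\<forall>f. \<forall>E\<in>sets borel.
           (\<Sum>j<N. emeasure (pvm_measure P (cadjoint (S j) f)) (\<sigma> j -` E)) =
             emeasure (pvm_measure P f) E) \<and>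
        (\<forall>f. \<forall>\<psi>::'x \<Rightarrow> complex. \<psi> \<in> borel_measurable borel \<and> bounded (range \<psi>) \<longrightarrow>
           (\<Sum>j<N. \<integral>x. \<psi> (\<sigma> j x) \<partial>pvm_measure P (cadjoint (S j) f)) =
             (\<integral>x. \<psi> x \<partial>pvm_measure P f)))"
proof -
  interpret cuntz_ifs N S \<sigma> using assms by unfold_locales
  show ?thesis
  proof (intro conjI allI impI)
    show "\<exists>!P. P \<in> extensional (sets borel) \<and> pvm P \<and> extends_cylinder_projections N S \<sigma> P"
    proof -
      obtain P where P: "P \<in> extensional (sets borel)" "cyl_pvm P" using cyl_pvm_exists by blast
      \<comment> \<open>Extensional functions that agree on every Borel set are equal.\<close>
      have "Q = P" if "Q \<in> extensional (sets borel)" "cyl_pvm Q" for Q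
        using that(1) P(1) by (rule extensionalityI) (rule cyl_pvm_unique[OF that(2) P(2)])
      with P show ?thesis unfolding cyl_pvm_iff[symmetric] by blast
    qed
  next
    fix P :: "'x set \<Rightarrow> 'h \<Rightarrow> 'h"
    assume *: "pvm P \<and> extends_cylinder_projections N S \<sigma> P"
    then have P: "cyl_pvm P" by (simp add: cyl_pvm_iff)
    show "\<forall>E\<in>sets borel. P E = cadjoint (P E) \<and> P E = P E \<circ> P E"
      using pvm_orth_projection[of P] * by (simp add: orth_projection_def)
    show "pvm_integral P (\<lambda>_. 1) = id" using * by (simp add: pvm_integral_one)
    show "\<forall>E\<in>sets borel. \<forall>F\<in>sets borel. E \<inter> F = {} \<longrightarrow> P E \<circ> P F = (\<lambda>_. 0)"
      using * by (simp add: pvm_def)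
    show "\<forall>E\<in>sets borel. (\<lambda>f. \<Sum>j<N. (S j \<circ> P (\<sigma> j -` E) \<circ> cadjoint (S j)) f) = P E"
      using cyl_pvm_self_similar[OF P] by (simp add: fun_eq_iff)
    show "\<forall>E\<in>sets borel. emeasure (pvm_measure P f) E = ennreal ((norm (P E f))\<^sup>2)" for f
      using * by (simp add: emeasure_pvm_measure)
    show "\<forall>E\<in>sets borel. (\<Sum>j<N. emeasure (pvm_measure P (cadjoint (S j) f)) (\<sigma> j -` E)) =
        emeasure (pvm_measure P f) E" for f
      using sum_emeasure_sigma[OF P] by blast
    show "(\<Sum>j<N. \<integral>x. \<psi> (\<sigma> j x) \<partial>pvm_measure P (cadjoint (S j) f)) = (\<integral>x. \<psi> x \<partial>pvm_measure P f)"
      if "\<psi> \<in> borel_measurable borel \<and> bounded (range \<psi>)" for f and \<psi> :: "'x \<Rightarrow> complex"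
      using sum_integral_sigma[OF P] that by blast
  qed
qed

end
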